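(* Let $\Bbbk$ be a field and $0\ne v\in\Bbbk$ with $[n]!\ne0$ in $\Bbbk$. For any $1$-factor $\alpha$ of length at most $n$ we have $$\eta(\alpha)=\sum_{\beta\le\alpha}\pi_{\alpha,\beta}\,\mu(\beta)$$ for some $\pi_{\alpha,\beta}\in\Bbbk$ with $\pi_{\alpha,\alpha}\ne0$, where the sum is over all $1$-factors $\beta$ of the same shape as $\alpha$ satisfying $\beta\le\alpha$. Hence the $\eta(\alpha)$ are related to the $\mu(\beta)$ by an invertible triangular matrix $P=(\pi_{\alpha,\beta})$, and the set of $\eta(\alpha)$ such that $\alpha$ has shape $\lambda$ is a $\Bbbk$-basis of the simple module $C(\lambda)$.
   Context: Quantum integers: for $k\ge0$, $[k]=\sum_{t=0}^{k-1}v^{k-1-2t}\in\Bbbk$, $[-k]=-[k]$, $[k]!=[1][2]\cdots[k]$, $[0]!=1$. $V$ is the two-dimensional space with basis $y_1,y_{-1}$ and operators $Fy_1=y_{-1}$, $Fy_{-1}=0$, $Ky_{\pm1}=v^{\pm1}y_{\pm1}$. On $V^{\otimes m}$, $F$ acts as $\sum_{j=1}^m1^{\otimes(j-1)}\otimes F\otimes(K^{-1})^{\otimes(m-j)}$; $y_{i_1}\otimes\cdots\otimes y_{i_m}$ ($i_j\in\{\pm1\}$) has weight $\sum_ji_j$. ($V^{\otimes0}=\Bbbk$, of weight $0$, with $F=0$.) For $b\in V^{\otimes(m-1)}$ of weight $i_b$, $\Phi_1(b)=b\otimes y_1$ and $\Phi_2(b)=[i_b]\,b\otimes y_{-1}-v^{i_b}Fb\otimes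 y_1$. A $1$-factor of length $l$ is a sequence $\alpha=(\alpha_1,\dots,\alpha_l)$ with $\alpha_i=\pm1$ and all partial sums $\alpha_1+\cdots+\alpha_i\ge0$. If $\alpha_i=1$ and $j$ is the smallest index with $i<j\le l$ and $\alpha_i+\cdots+\alpha_j=0$, then $(i,j)$ is a pairing of $\alpha$; unpaired indices are called defects. The shape of $\alpha$ is the partition $(l-p,p)$, where $p$ is the number of entries equal to $-1$. For $1$-factors of equal length, $\beta\le\alpha$ means $\beta_1+\cdots+\beta_j\le\alpha_1+\cdots+\alpha_j$ for every $j$. $\mu(\alpha)=\Upsilon_l\cdots\Upsilon_1(1)\in V^{\otimes l}$, where $\Upsilon_i=\Phi_1$ if $\alpha_i=1$ and $\Upsilon_i=\Phi_2$ if $\alpha_i=-1$. $\eta(\alpha)\in V^{\otimes l}$ is the tensor product, in order, of a factor $y_1$ for each defect and of nested links; explicitly: $\eta(\emptyset)=1$; if index $1$ is a defect, $\eta(\alpha)=y_1\otimes\eta(\alpha_2,\dots,\alpha_l)$; if $1$ is paired with $j$, $\eta(\alpha)=\Psi(\eta(\alpha_2,\dots,\alpha_{j-1}))\otimes\eta(\alpha_{j+1},\dots,\alpha_l)$, where $\Psi(b)=y_1\otimes b\otimes y_{-1}-v\,y_{-1}\otimes b\otimes y_1$. For a partition $\lambda$ of $l$ with at most two parts, $C(\lambda)\subseteq V^{\otimes l}$ is the $\Bbbk$-span of the $\mu(\beta)$ with $\beta$ of shape $\lambda$. It is a simple module for the Temperley--Lieb algebra $\mathrm{TL}_l(-(v+v^{-1}))$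 (generators $e_1,\dots,e_{l-1}$, relations $e_i^2=\delta e_i$ with $\delta=-(v+v^{-1})$, $e_ie_je_i=e_i$ if $|i-j|=1$, $e_ie_j=e_je_i$ if $|i-j|>1$), where $e_i$ acts in tensor positions $i,i+1$ by $y_1\otimes y_1\mapsto0$, $y_{-1}\otimes y_{-1}\mapsto0$, $y_1\otimes y_{-1}\mapsto-v^{-1}y_1\otimes y_{-1}+y_{-1}\otimes y_1$, $y_{-1}\otimes y_1\mapsto y_1\otimes y_{-1}-v\,y_{-1}\otimes y_1$. *)

theory Defs
  imports Complex_Main "HOL-Library.Poly_Mapping"
begin

section \<open>Quantum integers\<close>

definition qint :: "'a::field \<Rightarrow> int \<Rightarrow> 'a" where
  "qint v k =
     (if 0 \<le> k then (\<Sum>t<nat k. v powi (k - 1 - 2 * int t))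
      else - (\<Sum>t<nat (- k). v powi (- k - 1 - 2 * int t)))"

definition qfact :: "'a::field \<Rightarrow> nat \<Rightarrow> 'a" where
  "qfact v n = (\<Prod>k=1..n. qint v (int k))"

section \<open>Tensor powers of the two-dimensional space\<close>

text \<open>
  The tensor algebra of \<open>V\<close> is represented as the free vector space on words: the basis element
  \<open>word [i\<^sub>1, \<dots>, i\<^sub>m]\<close> is \<open>y\<^bsub>i\<^sub>1\<^esub> \<otimes> \<dots> \<otimes> y\<^bsub>i\<^sub>m\<^esub>\<close>, and \<open>V\<^bsup>\<otimes>m\<^esup>\<close> is the span of the words of length
  \<open>m\<close> with letters \<open>1\<close> and \<open>-1\<close>. All vectors built below from \<open>word []\<close> use only these letters.
\<close>

type_synonym 'a tens = "int list \<Rightarrow>\<^sub>0 'a"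

definition tscale :: "'a::field \<Rightarrow> 'a tens \<Rightarrow> 'a tens" where
  "tscale c x = Poly_Mapping.map ((*) c) x"

lemma lookup_tscale [simp]: "Poly_Mapping.lookup (tscale c x) w = c * Poly_Mapping.lookup x w"
  by (auto simp: tscale_def Poly_Mapping.map.rep_eq when_def)

interpretation tens: vector_space "tscale :: 'a::field \<Rightarrow> 'a tens \<Rightarrow> 'a tens"
  by unfold_locales
    (auto intro!: poly_mapping_eqI simp: lookup_add algebra_simps)

definition word :: "int list \<Rightarrow> 'a::field tens" where
  "word w = Poly_Mapping.single w 1"

definition linext :: "(int list \<Rightarrow> 'a::field tens) \<Rightarrow> 'a tens \<Rightarrow> 'a tens" where
  "linext f x = (\<Sum>w\<in>Poly_Mapping.keys x. tscale (Poly_Mapping.lookup x w) (f w))"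

definition tensor :: "'a::field tens \<Rightarrow> 'a tens \<Rightarrow> 'a tens" where
  "tensor x y = linext (\<lambda>u. linext (\<lambda>w. word (u @ w)) y) x"

definition tensor_list :: "'a::field tens list \<Rightarrow> 'a tens" where
  "tensor_list xs = foldr tensor xs (word [])"

definition yvec :: "int \<Rightarrow> 'a::field tens" where
  "yvec i = word [i]"

text \<open>\<open>F\<close> and \<open>K\<^sup>-\<^sup>1\<close> on the basis \<open>y\<^sub>1, y\<^sub>-\<^sub>1\<close> of \<open>V\<close>, and then \<open>F\<close> on tensor powers (\<open>Fop\<close>).\<close>

definition F1 :: "int \<Rightarrow> 'a::field tens" where
  "F1 i = (if i = 1 then yvec (- 1) else 0)"

definition Kinv1 :: "'a::field \<Rightarrow> int \<Rightarrow> 'a tens" where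
  "Kinv1 v i = tscale (v powi (- i)) (yvec i)"

definition Fop :: "'a::field \<Rightarrow> 'a tens \<Rightarrow> 'a tens" where
  "Fop v = linext (\<lambda>w. \<Sum>j<length w.
     tensor_list (map yvec (take j w) @ [F1 (w ! j)] @ map (Kinv1 v) (drop (Suc j) w)))"

definition Phi1 :: "'a::field tens \<Rightarrow> 'a tens" where
  "Phi1 b = tensor b (yvec 1)"

text \<open>
  \<open>\<Phi>\<^sub>2\<close> is extended linearly from the words \<open>w\<close>, which have weight \<open>sum_list w\<close>; on every vector of
  weight \<open>i\<close> it is therefore \<open>b \<mapsto> [i] b \<otimes> y\<^sub>-\<^sub>1 - v\<^sup>i F b \<otimes> y\<^sub>1\<close>.
\<close>

definition Phi2 :: "'a::field \<Rightarrow> 'a tens \<Rightarrow> 'a tens" where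
  "Phi2 v = linext (\<lambda>w.
     tscale (qint v (sum_list w)) (tensor (word w) (yvec (- 1)))
     - tscale (v powi sum_list w) (tensor (Fop v (word w)) (yvec 1)))"

definition Psi :: "'a::field \<Rightarrow> 'a tens \<Rightarrow> 'a tens" where
  "Psi v b = tensor (yvec 1) (tensor b (yvec (- 1)))
     - tscale v (tensor (yvec (- 1)) (tensor b (yvec 1)))"

section \<open>1-factors\<close>

definition one_factor :: "int list \<Rightarrow> bool" where
  "one_factor \<alpha> \<longleftrightarrow> set \<alpha> \<subseteq> {1, - 1} \<and> (\<forall>i\<le>length \<alpha>. 0 \<le> sum_list (take i \<alpha>))"

text \<open>Positions in a list are counted from 0, so index \<open>1\<close> of the sequence is position \<open>0\<close>.\<close>

definition pairing :: "int list \<Rightarrow> nat \<Rightarrow> nat \<Rightarrow> bool" where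
  "pairing \<alpha> i j \<longleftrightarrow> i < j \<and> j < length \<alpha> \<and> \<alpha> ! i = 1 \<and> (\<Sum>k=i..j. \<alpha> ! k) = 0
     \<and> (\<forall>j'. i < j' \<and> j' < j \<longrightarrow> (\<Sum>k=i..j'. \<alpha> ! k) \<noteq> 0)"

definition defect :: "int list \<Rightarrow> nat \<Rightarrow> bool" where
  "defect \<alpha> i \<longleftrightarrow> i < length \<alpha> \<and> (\<nexists>j. pairing \<alpha> i j \<or> pairing \<alpha> j i)"

definition shape :: "int list \<Rightarrow> nat \<times> nat" where
  "shape \<alpha> = (length \<alpha> - count_list \<alpha> (- 1), count_list \<alpha> (- 1))"

definition of_shape :: "nat \<times> nat \<Rightarrow> int list set" where
  "of_shape p = {\<alpha>. one_factor \<alpha> \<and> shape \<alpha> = p}"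

definition one_factor_le :: "int list \<Rightarrow> int list \<Rightarrow> bool" where
  "one_factor_le \<beta> \<alpha> \<longleftrightarrow> length \<beta> = length \<alpha>
     \<and> (\<forall>j\<le>length \<alpha>. sum_list (take j \<beta>) \<le> sum_list (take j \<alpha>))"

definition mu :: "'a::field \<Rightarrow> int list \<Rightarrow> 'a tens" where
  "mu v \<alpha> = foldl (\<lambda>b a. if a = 1 then Phi1 b else Phi2 v b) (word []) \<alpha>"

text \<open>
  If the first entry of \<open>a # \<alpha>\<close> (position 0) is paired with position \<open>j\<close>, then \<open>take (j - 1) \<alpha>\<close> and
  \<open>drop j \<alpha>\<close> are the parts strictly inside and strictly to the right of the pair.
\<close>

function eta :: "'a::field \<Rightarrow> int list \<Rightarrow> 'a tens" where
  "eta v [] = word []"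
| "eta v (a # \<alpha>) =
     (if defect (a # \<alpha>) 0 then tensor (yvec 1) (eta v \<alpha>)
      else (let j = THE j. pairing (a # \<alpha>) 0 j
            in tensor (Psi v (eta v (take (j - 1) \<alpha>))) (eta v (drop j \<alpha>))))"
  by pat_completeness auto
termination
  by (relation "measure (\<lambda>(v, \<alpha>). length \<alpha>)") auto

section \<open>The Temperley--Lieb modules\<close>

definition cell :: "'a::field \<Rightarrow> nat \<times> nat \<Rightarrow> 'a tens set" where
  "cell v p = tens.span (mu v ` of_shape p)"

definition e2 :: "'a::field \<Rightarrow> int \<Rightarrow> int \<Rightarrow> 'a tens" where
  "e2 v a b =
     (if a = 1 \<and> b = - 1 then word [- 1, 1] - tscale (inverse v) (word [1, - 1])
      else if a = - 1 \<and> b = 1 then word [1, - 1] - tscale v (word [- 1, 1])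
      else 0)"

text \<open>\<open>tl_e v i\<close> acts in the tensor positions \<open>i\<close> and \<open>i + 1\<close>, counted from 1.\<close>

definition tl_e :: "'a::field \<Rightarrow> nat \<Rightarrow> 'a tens \<Rightarrow> 'a tens" where
  "tl_e v i = linext (\<lambda>w. tensor (word (take (i - 1) w))
     (tensor (e2 v (w ! (i - 1)) (w ! i)) (word (drop (i + 1) w))))"

text \<open>
  A module for the algebra given by the generators \<open>e\<^sub>1, \<dots>, e\<^bsub>l-1\<^esub>\<close> and the Temperley--Lieb relations
  with loop parameter \<open>d\<close> is a vector space with linear operators \<open>e\<^sub>i\<close> satisfying these relations,
  and its submodules are the subspaces stable under all \<open>e\<^sub>i\<close>.
\<close>

definition TL_stable :: "nat \<Rightarrow> (nat \<Rightarrow> 'a::field tens \<Rightarrow> 'a tens) \<Rightarrow> 'a tens set \<Rightarrow> bool" where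
  "TL_stable l e W \<longleftrightarrow> tens.subspace W \<and> (\<forall>i\<in>{1..<l}. \<forall>x\<in>W. e i x \<in> W)"

definition TL_module ::
  "nat \<Rightarrow> 'a::field \<Rightarrow> (nat \<Rightarrow> 'a tens \<Rightarrow> 'a tens) \<Rightarrow> 'a tens set \<Rightarrow> bool" where
  "TL_module l d e M \<longleftrightarrow> TL_stable l e M
     \<and> (\<forall>i\<in>{1..<l}. \<forall>x\<in>M. \<forall>z\<in>M. e i (x + z) = e i x + e i z)
     \<and> (\<forall>i\<in>{1..<l}. \<forall>c. \<forall>x\<in>M. e i (tscale c x) = tscale c (e i x))
     \<and> (\<forall>i\<in>{1..<l}. \<forall>x\<in>M. e i (e i x) = tscale d (e i x))
     \<and> (\<forall>i\<in>{1..<l}. \<forall>j\<in>{1..<l}. (i = j + 1 \<or> j = i + 1) \<longrightarrow> (\<forall>x\<in>M. e i (e j (e i x)) = e i x))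
     \<and> (\<forall>i\<in>{1..<l}. \<forall>j\<in>{1..<l}. (i > j + 1 \<or> j > i + 1) \<longrightarrow> (\<forall>x\<in>M. e i (e j x) = e j (e i x)))"

definition simple_TL_module ::
  "nat \<Rightarrow> 'a::field \<Rightarrow> (nat \<Rightarrow> 'a tens \<Rightarrow> 'a tens) \<Rightarrow> 'a tens set \<Rightarrow> bool" where
  "simple_TL_module l d e M \<longleftrightarrow> TL_module l d e M \<and> M \<noteq> {0}
     \<and> (\<forall>W. W \<subseteq> M \<and> TL_stable l e W \<longrightarrow> W = {0} \<or> W = M)"

section \<open>Matrices indexed by a finite set\<close>

definition triangular_on :: "'i set \<Rightarrow> ('i \<Rightarrow> 'i \<Rightarrow> bool) \<Rightarrow> ('i \<Rightarrow> 'i \<Rightarrow> 'a::field) \<Rightarrow> bool" where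
  "triangular_on I le P \<longleftrightarrow> (\<forall>i\<in>I. \<forall>j\<in>I. P i j \<noteq> 0 \<longrightarrow> le j i)"

definition invertible_on :: "'i set \<Rightarrow> ('i \<Rightarrow> 'i \<Rightarrow> 'a::field) \<Rightarrow> bool" where
  "invertible_on I P \<longleftrightarrow> (\<exists>Q. \<forall>i\<in>I. \<forall>k\<in>I.
     (\<Sum>j\<in>I. P i j * Q j k) = (if i = k then 1 else 0)
     \<and> (\<Sum>j\<in>I. Q i j * P j k) = (if i = k then 1 else 0))"

end

theory Submission
  imports Defs
begin

text \<open>
  Three facts carry the proof. Write \<open>M\<close> for the span of the \<open>\<mu>(\<beta>)\<close> with \<open>\<beta>\<close> of a given length and weight.

  The first is a formula for a link. If \<open>x\<close> has weight \<open>i \<ge> 0\<close> and \<open>z\<close> has weight \<open>0\<close> with \<open>F z = 0\<close>, then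
  \<open>[i + 1] x \<otimes> \<Psi>(z) = \<Phi>\<^sub>2(\<Phi>\<^sub>1(x) \<otimes> z) - \<Phi>\<^sub>1(\<Phi>\<^sub>2(x) \<otimes> z)\<close> (\<open>tensor_Psi\<close>). The spaces \<open>M\<close> are stable under
  \<open>\<Phi>\<^sub>1\<close> and \<open>\<Phi>\<^sub>2\<close>; the only doubtful case is \<open>\<Phi>\<^sub>2\<close> in weight \<open>0\<close>, where \<open>\<Phi>\<^sub>2(\<mu>(\<beta>))\<close> is not attached to a
  1-factor, but there it vanishes, because \<open>F\<close> to the power \<open>i + 1\<close> kills every \<open>\<mu>(\<beta>)\<close> of weight \<open>i\<close>
  (\<open>Fop_power_mu\<close>). As the quantum integers \<open>[1], \<dots>, [n]\<close> are invertible, the link formula and induction on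
  the nesting of \<open>\<alpha>\<close> give \<open>x \<otimes> \<eta>(\<alpha>) \<in> M\<close> for \<open>x \<in> M\<close>, and in particular \<open>\<eta>(\<alpha>) \<in> M\<close>.

  The second is triangularity with respect to words. Every word that occurs in \<open>\<eta>(\<alpha>)\<close> or in \<open>\<mu>(\<alpha>)\<close> is \<open>\<le> \<alpha>\<close>,
  and the word \<open>\<alpha>\<close> itself occurs with a nonzero coefficient (\<open>eta_led_by\<close>, \<open>mu_led_by\<close>). Comparing maximal
  words in \<open>\<eta>(\<alpha>) = \<Sum> \<pi>\<^bsub>\<alpha>,\<beta>\<^esub> \<mu>(\<beta>)\<close> shows that only \<open>\<beta> \<le> \<alpha>\<close> occur and that \<open>\<pi>\<^bsub>\<alpha>,\<alpha>\<^esub> \<noteq> 0\<close>. It also shows that both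
  families are linearly independent; having the same size, they span the same space, and the matrix
  between them is invertible.

  The third is simplicity, by induction on the length \<open>l\<close>. The \<open>e\<^sub>i\<close> commute with \<open>F\<close>, hence with later
  applications of \<open>\<Phi>\<^sub>1\<close> and \<open>\<Phi>\<^sub>2\<close>, and on the last two letters \<open>e\<^bsub>l-1\<^esub>\<close> is given by quantum integers
  (\<open>tl_e_Phi_Phi\<close>). If the weight is \<open>l\<close>, the module is a line. Otherwise let \<open>W \<noteq> 0\<close> be a submodule. No
  nonzero vector of the module is killed by all \<open>e\<^sub>i\<close>, and therefore \<open>e\<^bsub>l-1\<^esub>\<close> does not kill \<open>W\<close>; its image consists of vectors
  \<open>z \<otimes> \<Psi>(1)\<close> with \<open>z\<close> in the module of length \<open>l - 2\<close>, which is simple by induction, and so \<open>W\<close> contains all of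
  these. Sliding the link \<open>\<Psi>(1)\<close> to the left with the \<open>e\<^sub>i\<close> and using the link formula once more, one moves
  the first \<open>-1\<close> of a 1-factor \<open>\<beta>\<close> to the left modulo \<open>W\<close> until it disappears, which gives \<open>\<mu>(\<beta>) \<in> W\<close>.
\<close>

section \<open>Linear calculus on words\<close>

notation tensor (infixr "\<otimes>" 75)

interpretation tens_pair: vector_space_pair
  "tscale :: 'a::field \<Rightarrow> 'a tens \<Rightarrow> 'a tens" "tscale :: 'a::field \<Rightarrow> 'a tens \<Rightarrow> 'a tens"
  by unfold_locales

abbreviation tlinear :: "('a::field tens \<Rightarrow> 'a tens) \<Rightarrow> bool" where
  "tlinear f \<equiv> Vector_Spaces.linear tscale tscale f"

lemma tlinear_iff: "tlinear f \<longleftrightarrow>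
    (\<forall>x y. f (x + y) = f x + f y) \<and> (\<forall>c x. f (tscale c x) = tscale c (f x))"
  by (simp add: Vector_Spaces.linear_iff tens.vector_space_axioms)

lemmas tlinearI = tlinear_iff[THEN iffD2]

lemma tlinear_add: "tlinear f \<Longrightarrow> f (x + y) = f x + f y"
  and tlinear_scale: "tlinear f \<Longrightarrow> f (tscale c x) = tscale c (f x)"
  by (simp_all add: tlinear_iff)

lemma tlinear_zero: "tlinear f \<Longrightarrow> f 0 = 0"
  and tlinear_diff: "tlinear f \<Longrightarrow> f (x - y) = f x - f y"
  and tlinear_sum: "tlinear f \<Longrightarrow> f (sum g A) = (\<Sum>i\<in>A. f (g i))"
  by (simp_all add: tens_pair.linear_0 tens_pair.linear_diff tens_pair.linear_sum)

lemma tlinear_ident: "tlinear (\<lambda>x. x)"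
  by (simp add: tlinear_iff)

lemma tlinear_const_scale: "tlinear f \<Longrightarrow> tlinear (\<lambda>x. tscale c (f x))"
  by (simp add: tlinear_iff tens.scale_right_distrib mult.commute)

lemma tlinear_plus: "tlinear f \<Longrightarrow> tlinear g \<Longrightarrow> tlinear (\<lambda>x. f x + g x)"
  by (simp add: tlinear_iff tens.scale_right_distrib algebra_simps)

lemma tlinear_minus: "tlinear f \<Longrightarrow> tlinear g \<Longrightarrow> tlinear (\<lambda>x. f x - g x)"
  by (simp add: tlinear_iff tens.scale_right_diff_distrib algebra_simps)

lemma lookup_word: "Poly_Mapping.lookup (word u) w = (if u = w then 1 else 0)"
  by (simp add: word_def lookup_single when_def)

lemma keys_word [simp]: "Poly_Mapping.keys (word u :: 'a::field tens) = {u}"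
  by (simp add: word_def)

lemma linext_superset:
  assumes "finite S" "Poly_Mapping.keys x \<subseteq> S"
  shows "linext f x = (\<Sum>w\<in>S. tscale (Poly_Mapping.lookup x w) (f w))"
  unfolding linext_def using assms
  by (intro sum.mono_neutral_left) (auto simp: in_keys_iff)

lemma tlinear_linext: "tlinear (linext f)"
proof (rule tlinearI, intro conjI allI)
  fix x y :: "'a tens" and c
  let ?S = "Poly_Mapping.keys x \<union> Poly_Mapping.keys y"
  have "Poly_Mapping.keys (x + y) \<subseteq> ?S" by (rule keys_add)
  then show "linext f (x + y) = linext f x + linext f y"
    by (subst (1 2 3) linext_superset[where S = ?S])
       (auto simp: lookup_add tens.scale_left_distrib sum.distrib)
  have "Poly_Mapping.keys (tscale c x) \<subseteq> Poly_Mapping.keys x"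
    by (auto simp: in_keys_iff)
  then show "linext f (tscale c x) = tscale c (linext f x)"
    by (subst (1 2) linext_superset[where S = "Poly_Mapping.keys x"])
       (auto simp: tens.scale_sum_right)
qed

lemma linext_word [simp]: "linext f (word w) = f w"
  by (simp add: linext_def lookup_word)

lemma linext_word_id: "linext word x = x"
proof (rule poly_mapping_eqI)
  fix w
  show "Poly_Mapping.lookup (linext word x) w = Poly_Mapping.lookup x w"
    by (cases "w \<in> Poly_Mapping.keys x")
       (auto simp: linext_def lookup_sum lookup_word if_distrib sum.delta in_keys_iff cong: if_cong)
qed

text \<open>
  Identities between operators are checked on words. Only the words in the support of \<open>x\<close> matter, so
  that hypotheses on the length or the weight of \<open>x\<close> become hypotheses on words.
\<close>

lemma tlinear_eq_on_words:
  assumes "tlinear f" "tlinear g" "\<And>w. w \<in> Poly_Mapping.keys x \<Longrightarrow> f (word w) = g (word w)"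
  shows "f x = g x"
proof -
  have "f (linext word x) = g (linext word x)"
    unfolding linext_def using assms by (simp add: tlinear_sum tlinear_scale)
  then show ?thesis by (simp add: linext_word_id)
qed

lemma tlinear_linext_fun:
  assumes "\<And>w. tlinear (f w)"
  shows "tlinear (\<lambda>y. linext (\<lambda>w. f w y) x)"
  unfolding linext_def
  by (rule tlinearI)
     (auto simp: tlinear_add[OF assms] tlinear_scale[OF assms] tens.scale_right_distrib
       sum.distrib tens.scale_sum_right mult.commute)

lemma tlinear_tensor_left: "tlinear (\<lambda>x. x \<otimes> y)"
  unfolding tensor_def by (rule tlinear_linext)

lemma tlinear_tensor_right: "tlinear (\<lambda>y. x \<otimes> y)"
  unfolding tensor_def by (rule tlinear_linext_fun) (rule tlinear_linext)

lemma tlinear_compose: "tlinear f \<Longrightarrow> tlinear g \<Longrightarrow> tlinear (\<lambda>x. f (g x))"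
  by (simp add: tlinear_iff)

lemmas tensor_bilinear =
  tlinear_add[OF tlinear_tensor_left] tlinear_add[OF tlinear_tensor_right]
  tlinear_scale[OF tlinear_tensor_left] tlinear_scale[OF tlinear_tensor_right]
  tlinear_zero[OF tlinear_tensor_left] tlinear_zero[OF tlinear_tensor_right]
  tlinear_diff[OF tlinear_tensor_left] tlinear_diff[OF tlinear_tensor_right]

lemma tensor_word [simp]: "word u \<otimes> word w = word (u @ w)"
  by (simp add: tensor_def)

lemma tlinear_tensorL: "tlinear f \<Longrightarrow> tlinear (\<lambda>x. f x \<otimes> y)"
  and tlinear_tensorR: "tlinear f \<Longrightarrow> tlinear (\<lambda>x. y \<otimes> f x)"
  by (rule tlinear_compose[OF tlinear_tensor_left], assumption,
      rule tlinear_compose[OF tlinear_tensor_right], assumption)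

lemma tlinear_linext_comp: "tlinear f \<Longrightarrow> tlinear (\<lambda>x. linext g (f x))"
  by (rule tlinear_compose[OF tlinear_linext])

lemmas tlinear_intros = tlinear_ident tlinear_const_scale tlinear_plus tlinear_minus
  tlinear_tensorL tlinear_tensorR tlinear_linext_comp

lemma tensor_assoc: "(x \<otimes> y) \<otimes> z = x \<otimes> y \<otimes> z"
proof (rule tlinear_eq_on_words[where x = x])
  fix u
  show "(word u \<otimes> y) \<otimes> z = word u \<otimes> y \<otimes> z"
  proof (rule tlinear_eq_on_words[where x = y])
    fix w
    show "(word u \<otimes> word w) \<otimes> z = word u \<otimes> word w \<otimes> z"
      by (rule tlinear_eq_on_words[where x = z]) (auto intro!: tlinear_intros)
  qed (auto intro!: tlinear_intros)
qed (auto intro!: tlinear_intros)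

lemma tensor_unit [simp]: "word [] \<otimes> x = x" "x \<otimes> word [] = x"
  by (rule tlinear_eq_on_words[where x = x], auto intro!: tlinear_intros)+

section \<open>Homogeneous vectors\<close>

text \<open>
  The weight spaces of \<open>V\<^bsup>\<otimes>l\<^esup>\<close>. The condition on the letters cuts the free vector space on all integer
  words down to \<open>V\<^bsup>\<otimes>l\<^esup>\<close>; the relation \<open>e\<^sub>i e\<^sub>j e\<^sub>i = e\<^sub>i\<close> fails on words with other letters.
\<close>

definition homog :: "nat \<Rightarrow> int \<Rightarrow> 'a::field tens set" where
  "homog l r = {x. \<forall>w\<in>Poly_Mapping.keys x. length w = l \<and> set w \<subseteq> {1, - 1} \<and> sum_list w = r}"

lemma homogD:
  "x \<in> homog l r \<Longrightarrow> w \<in> Poly_Mapping.keys x \<Longrightarrow> length w = l \<and> set w \<subseteq> {1, - 1} \<and> sum_list w = r"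
  by (auto simp: homog_def)

lemma subspace_support: "tens.subspace {x. \<forall>w\<in>Poly_Mapping.keys x. P w}"
proof (rule tens.subspaceI)
  fix x y :: "'a tens"
  assume "x \<in> {x. \<forall>w\<in>Poly_Mapping.keys x. P w}" "y \<in> {x. \<forall>w\<in>Poly_Mapping.keys x. P w}"
  then show "x + y \<in> {x. \<forall>w\<in>Poly_Mapping.keys x. P w}"
    using keys_add[of x y] by blast
next
  fix x :: "'a tens" and c
  assume "x \<in> {x. \<forall>w\<in>Poly_Mapping.keys x. P w}"
  then show "tscale c x \<in> {x. \<forall>w\<in>Poly_Mapping.keys x. P w}"
    by (auto simp: in_keys_iff)
qed simp

lemma subspace_homog: "tens.subspace (homog l r)"
  unfolding homog_def by (rule subspace_support)

lemma tlinear_image_subspace: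
  assumes "tlinear f" "tens.subspace S" "\<And>w. w \<in> Poly_Mapping.keys x \<Longrightarrow> f (word w) \<in> S"
  shows "f x \<in> S"
proof -
  have "f (linext word x) \<in> S"
    unfolding linext_def using assms
    by (auto simp: tlinear_sum tlinear_scale intro!: tens.subspace_sum tens.subspace_scale)
  then show ?thesis by (simp add: linext_word_id)
qed

lemma word_homog: "set w \<subseteq> {1, - 1} \<Longrightarrow> length w = l \<Longrightarrow> sum_list w = r \<Longrightarrow> word w \<in> homog l r"
  by (simp add: homog_def)

lemma word_homog_iff [simp]:
  "word w \<in> (homog l r :: 'a::field tens set) \<longleftrightarrow> length w = l \<and> set w \<subseteq> {1, - 1} \<and> sum_list w = r"
  by (simp add: homog_def)

lemma tensor_homog:
  assumes x: "x \<in> homog l r" and y: "y \<in> homog m s"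
  shows "x \<otimes> y \<in> homog (l + m) (r + s)"
proof (rule tlinear_image_subspace[OF tlinear_tensor_left subspace_homog])
  fix u assume u: "u \<in> Poly_Mapping.keys x"
  show "word u \<otimes> y \<in> homog (l + m) (r + s)"
  proof (rule tlinear_image_subspace[OF tlinear_tensor_right subspace_homog])
    fix w assume w: "w \<in> Poly_Mapping.keys y"
    show "word u \<otimes> word w \<in> homog (l + m) (r + s)"
      unfolding tensor_word using homogD[OF x u] homogD[OF y w] by (intro word_homog) auto
  qed
qed

section \<open>The operator F\<close>

lemma tlinear_Fop: "tlinear (Fop v)"
  unfolding Fop_def by (rule tlinear_linext)

lemma tlinear_Fop_comp: "tlinear f \<Longrightarrow> tlinear (\<lambda>x. Fop v (f x))"
  by (rule tlinear_compose[OF tlinear_Fop])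

lemma tensor_list_append: "tensor_list (xs @ ys) = tensor_list xs \<otimes> tensor_list ys"
  by (induction xs) (auto simp: tensor_list_def tensor_assoc)

lemma tensor_list_simps: "tensor_list [x] = x" "tensor_list [] = word []"
  by (simp_all add: tensor_list_def)

lemma tensor_list_yvec: "tensor_list (map yvec w) = word w"
  by (induction w) (auto simp: tensor_list_def yvec_def)

lemma Fop_word_snoc:
  "Fop v (word (w @ [s])) = tscale (v powi (- s)) (Fop v (word w) \<otimes> word [s]) + word w \<otimes> F1 s"
proof -
  have "Fop v (word (w @ [s])) =
    (\<Sum>j<length w. tensor_list (map yvec (take j w) @ [F1 (w ! j)] @ map (Kinv1 v) (drop (Suc j) w))
       \<otimes> Kinv1 v s) + word w \<otimes> F1 s"
    by (simp add: Fop_def tensor_list_append tensor_list_yvec nth_append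
        tensor_list_simps tensor_assoc flip: append_assoc append_Cons)
  also have "\<dots> = Fop v (word w) \<otimes> Kinv1 v s + word w \<otimes> F1 s"
    by (simp add: Fop_def tlinear_sum[OF tlinear_tensor_left])
  finally show ?thesis
    by (simp add: Kinv1_def yvec_def tensor_bilinear)
qed

lemma Fop_word_Nil [simp]: "Fop v (word []) = 0"
  by (simp add: Fop_def)

lemma Fop_snoc:
  "Fop v (x \<otimes> word [s]) = tscale (v powi (- s)) (Fop v x \<otimes> word [s]) + x \<otimes> F1 s"
  by (rule tlinear_eq_on_words[where x = x])
     (auto simp: Fop_word_snoc intro!: tlinear_intros tlinear_Fop_comp)

lemma Fop_tensor_word:
  assumes "v \<noteq> 0"
  shows "Fop v (x \<otimes> word w) = tscale (v powi (- sum_list w)) (Fop v x \<otimes> word w) + x \<otimes> Fop v (word w)"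
proof (induction w rule: rev_induct)
  case (snoc s w)
  have "Fop v (x \<otimes> word (w @ [s])) = Fop v ((x \<otimes> word w) \<otimes> word [s])"
    by (simp add: tensor_assoc)
  also have "\<dots> = tscale (v powi (- s)) (Fop v (x \<otimes> word w) \<otimes> word [s]) + (x \<otimes> word w) \<otimes> F1 s"
    by (rule Fop_snoc)
  also have "\<dots> = tscale (v powi (- sum_list (w @ [s]))) (Fop v x \<otimes> word (w @ [s]))
     + x \<otimes> Fop v (word (w @ [s]))"
    using assms
    by (simp add: snoc.IH Fop_word_snoc tensor_bilinear tensor_assoc tens.scale_right_distrib
        power_int_diff power_int_minus field_simps)
  finally show ?case .
qed (simp add: tensor_bilinear)

text \<open>
  The coproduct rule \<open>\<Delta>(F) = F \<otimes> K\<^sup>-\<^sup>1 + 1 \<otimes> F\<close>.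
\<close>

lemma Fop_tensor:
  assumes "v \<noteq> 0" "z \<in> homog m k"
  shows "Fop v (x \<otimes> z) = tscale (v powi (- k)) (Fop v x \<otimes> z) + x \<otimes> Fop v z"
proof (rule tlinear_eq_on_words[where x = z])
  fix w assume "w \<in> Poly_Mapping.keys z"
  then show "Fop v (x \<otimes> word w) = tscale (v powi (- k)) (Fop v x \<otimes> word w) + x \<otimes> Fop v (word w)"
    using Fop_tensor_word[OF assms(1), of x w] homogD[OF assms(2)] by auto
qed (auto intro!: tlinear_intros tlinear_Fop_comp)

lemma F1_simps [simp]: "F1 1 = word [- 1]" "F1 (- 1) = 0"
  by (simp_all add: F1_def yvec_def)

lemma Fop_letter: "Fop v (word [s]) = F1 s"
  using Fop_word_snoc[of v "[]" s] by (simp add: tensor_bilinear)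

lemma Fop_homog: "x \<in> homog l r \<Longrightarrow> Fop v x \<in> homog l (r - 2)"
proof (rule tlinear_image_subspace[where x = x, OF tlinear_Fop subspace_homog])
  fix w assume x: "x \<in> homog l r" "w \<in> Poly_Mapping.keys x"
  have "set w \<subseteq> {1, - 1} \<Longrightarrow> Fop v (word w) \<in> homog (length w) (sum_list w - 2)"
  proof (induction w rule: rev_induct)
    case (snoc s w)
    have "word w \<otimes> F1 s \<in> homog (length w + 1) (sum_list w + s - 2)"
      using snoc.prems by (auto intro: tens.subspace_0[OF subspace_homog] simp: tensor_bilinear)
    moreover have "Fop v (word w) \<otimes> word [s] \<in> homog (length w + 1) ((sum_list w - 2) + s)"
      using snoc by (intro tensor_homog word_homog) auto
    ultimately show ?case
      by (auto simp: Fop_word_snoc algebra_simps intro!: tens.subspace_add[OF subspace_homog]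
          tens.subspace_scale[OF subspace_homog])
  qed (auto intro: tens.subspace_0[OF subspace_homog])
  with homogD[OF x] show "Fop v (word w) \<in> homog l (r - 2)" by auto
qed

section \<open>The operators \<open>\<Phi>\<^sub>1\<close> and \<open>\<Phi>\<^sub>2\<close>\<close>

lemma tlinear_Phi1: "tlinear Phi1"
  unfolding Phi1_def by (intro tlinear_intros)

lemma tlinear_Phi2: "tlinear (Phi2 v)"
  unfolding Phi2_def by (rule tlinear_linext)

lemma Phi1_eq: "Phi1 x = x \<otimes> word [1]"
  by (simp add: Phi1_def yvec_def)

text \<open>
  On a weight space the weight-dependent coefficients of \<open>\<Phi>\<^sub>2\<close> are constant, which brings back the usual
  formula.
\<close>

lemma Phi2_eq:
  assumes "x \<in> homog l r"
  shows "Phi2 v x = tscale (qint v r) (x \<otimes> word [- 1]) - tscale (v powi r) (Fop v x \<otimes> word [1])"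
proof (rule tlinear_eq_on_words[where x = x])
  fix w assume "w \<in> Poly_Mapping.keys x"
  then show "Phi2 v (word w) =
      tscale (qint v r) (word w \<otimes> word [- 1]) - tscale (v powi r) (Fop v (word w) \<otimes> word [1])"
    using homogD[OF assms] by (simp add: Phi2_def yvec_def)
qed (auto intro!: tlinear_intros tlinear_Fop_comp tlinear_Phi2)

lemma Phi1_homog: "x \<in> homog l r \<Longrightarrow> Phi1 x \<in> homog (Suc l) (r + 1)"
  using tensor_homog[OF _ word_homog[of "[1]" 1 1]] by (auto simp: Phi1_eq)

lemma Phi2_homog:
  assumes "x \<in> homog l r" shows "Phi2 v x \<in> homog (Suc l) (r - 1)"
proof -
  have "x \<otimes> word [- 1] \<in> homog (Suc l) (r - 1)"
    using tensor_homog[OF assms word_homog[of "[- 1]" 1 "- 1"]] by auto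
  moreover have "Fop v x \<otimes> word [1] \<in> homog (Suc l) (r - 1)"
    using tensor_homog[OF Fop_homog[OF assms] word_homog[of "[1]" 1 1]] by auto
  ultimately show ?thesis
    unfolding Phi2_eq[OF assms]
    by (intro tens.subspace_diff[OF subspace_homog] tens.subspace_scale[OF subspace_homog])
qed

section \<open>Quantum integers\<close>

lemma qint_0 [simp]: "qint v 0 = 0"
  by (simp add: qint_def)

lemma qint_1 [simp]: "qint v 1 = 1"
  by (simp add: qint_def)

text \<open>
  The two ways to split \<open>[k + 1]\<close>: at its highest and at its lowest power of \<open>v\<close>.
\<close>

lemma qint_succ:
  assumes "v \<noteq> 0" "0 \<le> k"
  shows "qint v (k + 1) = v powi k + inverse v * qint v k"
    and "qint v (k + 1) = v * qint v k + v powi (- k)"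
proof -
  obtain m where k: "k = int m" using assms(2) nonneg_int_cases by blast
  have n: "nat (int m + 1) = Suc m" by simp
  have "(\<Sum>t<m. v powi (int m - 2 * int (Suc t))) = inverse v * (\<Sum>t<m. v powi (int m - 1 - 2 * int t))"
    unfolding sum_distrib_left
    using assms(1) by (intro sum.cong refl) (simp add: power_int_diff power_int_add field_simps power2_eq_square)
  then show "qint v (k + 1) = v powi k + inverse v * qint v k"
    by (simp add: k qint_def n diff_diff_eq sum.lessThan_Suc_shift del: sum.lessThan_Suc)
  have "(\<Sum>t<m. v powi (int m - 2 * int t)) = v * (\<Sum>t<m. v powi (int m - 1 - 2 * int t))"
    unfolding sum_distrib_left
    using assms(1) by (intro sum.cong refl) (simp add: power_int_diff power_int_add field_simps power2_eq_square)
  then show "qint v (k + 1) = v * qint v k + v powi (- k)"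
    by (simp add: k qint_def n)
qed

lemma qint_nonzero:
  assumes "qfact v n \<noteq> 0" "1 \<le> k" "k \<le> int n"
  shows "qint v k \<noteq> 0"
proof -
  have "\<forall>j\<in>{1..n}. qint v (int j) \<noteq> 0"
    using assms(1) by (simp add: qfact_def)
  moreover from assms(2,3) have "nat k \<in> {1..n}" "int (nat k) = k" by auto
  ultimately show ?thesis by metis
qed


section \<open>1-factors\<close>

lemma one_factor_Nil [simp]: "one_factor []"
  by (simp add: one_factor_def)

lemma one_factor_append:
  "one_factor (\<alpha> @ \<beta>) \<longleftrightarrow> one_factor \<alpha> \<and> set \<beta> \<subseteq> {1, - 1}
     \<and> (\<forall>i\<le>length \<beta>. 0 \<le> sum_list \<alpha> + sum_list (take i \<beta>))" (is "?L \<longleftrightarrow> ?R")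
proof
  assume L: ?L
  have "0 \<le> sum_list (take i \<alpha>)" if "i \<le> length \<alpha>" for i
    using L that unfolding one_factor_def by (auto dest!: spec[where x = i])
  moreover have "0 \<le> sum_list \<alpha> + sum_list (take i \<beta>)" if "i \<le> length \<beta>" for i
    using L that unfolding one_factor_def by (auto dest!: spec[where x = "length \<alpha> + i"])
  ultimately show ?R using L by (auto simp: one_factor_def)
next
  assume R: ?R
  have "0 \<le> sum_list (take i (\<alpha> @ \<beta>))" if "i \<le> length (\<alpha> @ \<beta>)" for i
  proof (cases "i \<le> length \<alpha>")
    case True then show ?thesis using R by (auto simp: one_factor_def)
  next
    case False
    then show ?thesis using R that by auto
  qed
  then show ?L using R by (auto simp: one_factor_def)
qed

lemma one_factor_sum_nonneg: "one_factor \<alpha> \<Longrightarrow> 0 \<le> sum_list \<alpha>"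
  using one_factor_append[of \<alpha> "[]"] by simp

lemma one_factor_letters: "one_factor \<alpha> \<Longrightarrow> set \<alpha> \<subseteq> {1, - 1}"
  by (simp add: one_factor_def)

lemma one_factor_snoc:
  "one_factor (\<alpha> @ [a]) \<longleftrightarrow> one_factor \<alpha> \<and> (a = 1 \<or> a = - 1) \<and> 0 \<le> sum_list \<alpha> + a"
  by (auto simp: one_factor_append le_Suc_eq one_factor_sum_nonneg)

lemma one_factor_sum_le_length: "set \<alpha> \<subseteq> {1, - 1} \<Longrightarrow> sum_list \<alpha> \<le> int (length \<alpha>)"
  by (induction \<alpha>) auto

text \<open>
  The 1-factors of one shape, described by length and weight. For \<open>b \<le> a\<close> the shape \<open>(a, b)\<close> amounts to
  length \<open>a + b\<close> and weight \<open>a - b\<close>, and these behave better than partitions under adding letters.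
\<close>

definition factors :: "nat \<Rightarrow> int \<Rightarrow> int list set" where
  "factors l r = {\<beta>. one_factor \<beta> \<and> length \<beta> = l \<and> sum_list \<beta> = r}"

lemma factors_bounds: "\<beta> \<in> factors l r \<Longrightarrow> 0 \<le> r \<and> r \<le> int l"
  using one_factor_sum_nonneg one_factor_sum_le_length one_factor_letters
  by (auto simp: factors_def)

lemma finite_factors: "finite (factors l r)"
proof (rule finite_subset)
  show "factors l r \<subseteq> {xs. set xs \<subseteq> {1, - 1} \<and> length xs = l}"
    by (auto simp: factors_def dest: one_factor_letters)
  show "finite {xs. set xs \<subseteq> {1, - 1 :: int} \<and> length xs = l}"
    by (rule finite_lists_length_eq) simp
qed

lemma sum_list_letters: "set \<alpha> \<subseteq> {1, - 1} \<Longrightarrow> sum_list \<alpha> = int (length \<alpha>) - 2 * int (count_list \<alpha> (- 1))"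
  by (induction \<alpha>) auto

lemma of_shape_factors:
  assumes "b \<le> a" shows "of_shape (a, b) = factors (a + b) (int a - int b)"
proof -
  have "count_list \<alpha> (- 1) \<le> length \<alpha>" for \<alpha> :: "int list" by (rule count_le_length)
  then show ?thesis
    using sum_list_letters one_factor_letters
    by (fastforce simp: of_shape_def factors_def shape_def)
qed

section \<open>The vectors \<open>\<mu>\<close>\<close>

lemma mu_Nil [simp]: "mu v [] = word []"
  by (simp add: mu_def)

lemma mu_snoc: "mu v (\<alpha> @ [1]) = Phi1 (mu v \<alpha>)" "mu v (\<alpha> @ [- 1]) = Phi2 v (mu v \<alpha>)"
  by (simp_all add: mu_def)

lemma mu_homog: "set \<alpha> \<subseteq> {1, - 1} \<Longrightarrow> mu v \<alpha> \<in> homog (length \<alpha>) (sum_list \<alpha>)"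
proof (induction \<alpha> rule: rev_induct)
  case (snoc a \<alpha>)
  then have "a = 1 \<or> a = - 1" by auto
  with snoc show ?case by (auto simp: mu_snoc dest: Phi1_homog Phi2_homog)
qed simp

text \<open>
  The coproduct rule iterated. The coefficients \<open>v\<^bsup>-k\<^esup> + v [k]\<close> that accumulate in front of
  \<open>F\<^sup>k x \<otimes> y\<^bsub>-1\<^esub>\<close> are again quantum integers.
\<close>

lemma Fop_power_tensor:
  assumes "v \<noteq> 0"
  shows "(Fop v ^^ k) (x \<otimes> word [- 1]) = tscale (v ^ k) ((Fop v ^^ k) x \<otimes> word [- 1])"
    and "(Fop v ^^ Suc k) (x \<otimes> word [1]) =
      tscale (inverse v ^ Suc k) ((Fop v ^^ Suc k) x \<otimes> word [1])
      + tscale (qint v (int (Suc k))) ((Fop v ^^ k) x \<otimes> word [- 1])"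
proof -
  show "(Fop v ^^ k) (x \<otimes> word [- 1]) = tscale (v ^ k) ((Fop v ^^ k) x \<otimes> word [- 1])"
    by (induction k)
       (simp_all add: Fop_snoc tlinear_scale[OF tlinear_Fop] tensor_bilinear mult.commute)
  show "(Fop v ^^ Suc k) (x \<otimes> word [1]) =
      tscale (inverse v ^ Suc k) ((Fop v ^^ Suc k) x \<otimes> word [1])
      + tscale (qint v (int (Suc k))) ((Fop v ^^ k) x \<otimes> word [- 1])"
  proof (induction k)
    case 0
    then show ?case by (simp add: Fop_snoc power_int_minus)
  next
    case (Suc k)
    have q: "qint v (int (Suc (Suc k))) = v * qint v (int (Suc k)) + inverse v ^ Suc k"
    proof -
      have "v powi (- int (Suc k)) = inverse v ^ Suc k"
        by (simp only: power_int_minus power_int_of_nat power_inverse)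
      moreover have "int (Suc k) + 1 = int (Suc (Suc k))" by simp
      ultimately show ?thesis using qint_succ(2)[OF assms, of "int (Suc k)"] by (simp only:)
    qed
    have "(Fop v ^^ Suc (Suc k)) (x \<otimes> word [1]) = Fop v ((Fop v ^^ Suc k) (x \<otimes> word [1]))"
      by simp
    also have "\<dots> = tscale (inverse v ^ Suc (Suc k)) ((Fop v ^^ Suc (Suc k)) x \<otimes> word [1])
      + tscale (inverse v ^ Suc k + v * qint v (int (Suc k))) ((Fop v ^^ Suc k) x \<otimes> word [- 1])"
      unfolding Suc.IH
      by (simp add: tlinear_add[OF tlinear_Fop] tlinear_scale[OF tlinear_Fop] Fop_snoc
          tensor_bilinear tens.scale_left_distrib tens.scale_right_distrib power_int_minus mult_ac
          del: of_nat_Suc)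
    finally show ?case by (simp only: q add.commute)
  qed
qed

text \<open>
  The \<open>F\<close>-string of a highest weight vector of weight \<open>r\<close> has length at most \<open>r + 1\<close>. Passing from \<open>x\<close> of
  weight \<open>r\<close> to \<open>\<Phi>\<^sub>1(x)\<close> raises the exponent by one, and both resulting terms involve \<open>F\<^bsup>r+1\<^esup> x\<close> or
  \<open>F\<^bsup>r+2\<^esup> x\<close>. For \<open>\<Phi>\<^sub>2(x)\<close> the exponent drops to \<open>r\<close>, and there the two terms in \<open>F\<^sup>r x \<otimes> y\<^bsub>-1\<^esub>\<close>
  cancel; this is what the coefficients in \<open>\<Phi>\<^sub>2\<close> are made for.
\<close>

lemma Fop_power_mu:
  assumes "v \<noteq> 0" "one_factor \<beta>"
  shows "(Fop v ^^ Suc (nat (sum_list \<beta>))) (mu v \<beta>) = 0"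
  using assms(2)
proof (induction \<beta> rule: rev_induct)
  case (snoc a \<beta>)
  then have \<beta>: "one_factor \<beta>" "set \<beta> \<subseteq> {1, - 1}" and a: "a = 1 \<or> a = - 1" "0 \<le> sum_list \<beta> + a"
    by (auto simp: one_factor_snoc one_factor_letters)
  define m where "m = nat (sum_list \<beta>)"
  have m: "sum_list \<beta> = int m" using one_factor_sum_nonneg[OF \<beta>(1)] by (simp add: m_def)
  have x: "mu v \<beta> \<in> homog (length \<beta>) (int m)" using mu_homog[OF \<beta>(2)] m by simp
  have IH: "(Fop v ^^ Suc m) (mu v \<beta>) = 0" using snoc.IH \<beta>(1) by (simp add: m)
  then have IH': "(Fop v ^^ Suc (Suc m)) (mu v \<beta>) = 0" by (simp add: tlinear_zero[OF tlinear_Fop])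
  have lin: "tlinear (Fop v ^^ k)" for k
    by (induction k) (auto intro: tlinear_Fop_comp tlinear_ident simp: id_def o_def)
  show ?case
  proof (cases "a = 1")
    case True
    then have "nat (sum_list (\<beta> @ [a])) = Suc m" by (simp add: m)
    with True IH IH' show ?thesis
      by (simp add: mu_snoc Phi1_eq Fop_power_tensor(2)[OF assms(1)] tensor_bilinear
          del: funpow.simps(2))
  next
    case False
    with a m obtain p where a1: "a = - 1" and p: "m = Suc p" by (cases m) auto
    then have "nat (sum_list (\<beta> @ [a])) = p" by (simp add: m)
    moreover have "(Fop v ^^ Suc p) (Phi2 v (mu v \<beta>)) = 0"
    proof -
      have "(Fop v ^^ k) (Fop v (mu v \<beta>)) = (Fop v ^^ Suc k) (mu v \<beta>)" for k
        by (simp add: funpow_swap1)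
      then show ?thesis
        using IH assms(1) unfolding Phi2_eq[OF x]
        by (simp add: tlinear_diff[OF lin] tlinear_scale[OF lin] Fop_power_tensor[OF assms(1)]
            tensor_bilinear p mult.commute power_int_add del: funpow.simps(2) of_nat_Suc flip: power_int_of_nat)
    qed
    ultimately show ?thesis by (simp only: a1 mu_snoc)
  qed
qed (simp add: tlinear_zero[OF tlinear_Fop])

lemma Fop_mu_zero: "v \<noteq> 0 \<Longrightarrow> one_factor \<beta> \<Longrightarrow> sum_list \<beta> = 0 \<Longrightarrow> Fop v (mu v \<beta>) = 0"
  using Fop_power_mu[of v \<beta>] by simp

section \<open>The span of the \<open>\<mu>\<close>\<close>

definition mu_span :: "'a::field \<Rightarrow> nat \<Rightarrow> int \<Rightarrow> 'a tens set" where
  "mu_span v l r = tens.span (mu v ` factors l r)"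

lemma subspace_mu_span: "tens.subspace (mu_span v l r)"
  by (simp add: mu_span_def)

lemma mu_in_mu_span: "one_factor \<beta> \<Longrightarrow> mu v \<beta> \<in> mu_span v (length \<beta>) (sum_list \<beta>)"
  by (auto simp: mu_span_def factors_def intro!: tens.span_base)

lemma tlinear_vimage_subspace: "tlinear f \<Longrightarrow> tens.subspace S \<Longrightarrow> tens.subspace {x. f x \<in> S}"
  by (rule tens.subspaceI)
     (auto simp: tlinear_zero tlinear_add tlinear_scale tens.subspace_0 tens.subspace_add tens.subspace_scale)

lemma mu_span_induct:
  assumes "x \<in> mu_span v l r" "tlinear f" "tens.subspace S"
    "\<And>\<beta>. one_factor \<beta> \<Longrightarrow> length \<beta> = l \<Longrightarrow> sum_list \<beta> = r \<Longrightarrow> f (mu v \<beta>) \<in> S"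
  shows "f x \<in> S"
  using tens.span_induct[OF assms(1)[unfolded mu_span_def] tlinear_vimage_subspace[OF assms(2,3)]] assms(4)
  by (auto simp: factors_def)

lemma mu_span_homog: "x \<in> mu_span v l r \<Longrightarrow> x \<in> homog l r"
  by (rule mu_span_induct[OF _ tlinear_ident subspace_homog])
     (use mu_homog one_factor_letters in auto)

lemma mu_span_trivial:
  assumes "x \<in> mu_span v l r" "\<not> (0 \<le> r \<and> r \<le> int l)" shows "x = 0"
proof -
  have "factors l r = {}" using factors_bounds assms(2) by blast
  with assms(1) show ?thesis by (simp add: mu_span_def)
qed

lemma Phi1_mu_span: "x \<in> mu_span v l r \<Longrightarrow> Phi1 x \<in> mu_span v (Suc l) (r + 1)"
proof (rule mu_span_induct[OF _ tlinear_Phi1 subspace_mu_span])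
  fix \<beta> assume "one_factor \<beta>" "length \<beta> = l" "sum_list \<beta> = r"
  then show "Phi1 (mu v \<beta>) \<in> mu_span v (Suc l) (r + 1)"
    using mu_in_mu_span[of "\<beta> @ [1]" v] one_factor_sum_nonneg[of \<beta>]
    by (simp add: mu_snoc one_factor_snoc)
qed

text \<open>
  In weight \<open>0\<close> both \<open>[0]\<close> and \<open>F \<mu>(\<beta>)\<close> vanish. This replaces the sequence \<open>\<beta>\<close> followed by \<open>-1\<close>, which is
  not a 1-factor.
\<close>

lemma Phi2_mu_zero:
  assumes "v \<noteq> 0" "one_factor \<beta>" "sum_list \<beta> = 0" shows "Phi2 v (mu v \<beta>) = 0"
  using Phi2_eq[OF mu_homog[OF one_factor_letters[OF assms(2)]], of v] Fop_mu_zero[OF assms] assms(3)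
  by (simp add: tensor_bilinear)

lemma Phi2_mu_span: 
  assumes "v \<noteq> 0"
  shows "x \<in> mu_span v l r \<Longrightarrow> Phi2 v x \<in> mu_span v (Suc l) (r - 1)"
proof (rule mu_span_induct[OF _ tlinear_Phi2 subspace_mu_span])
  fix \<beta> assume \<beta>: "one_factor \<beta>" "length \<beta> = l" "sum_list \<beta> = r"
  show "Phi2 v (mu v \<beta>) \<in> mu_span v (Suc l) (r - 1)"
  proof (cases "r = 0")
    case True
    then show ?thesis using Phi2_mu_zero[OF assms] \<beta> tens.subspace_0[OF subspace_mu_span] by metis
  next
    case False
    then show ?thesis
      using \<beta> mu_in_mu_span[of "\<beta> @ [- 1]" v] one_factor_sum_nonneg[of \<beta>]
      by (simp add: mu_snoc one_factor_snoc)
  qed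
qed

lemma Fop_mu_span_zero: "v \<noteq> 0 \<Longrightarrow> x \<in> mu_span v l 0 \<Longrightarrow> Fop v x = 0"
  using mu_span_induct[OF _ tlinear_Fop tens.subspace_single_0, of x v l 0 v] Fop_mu_zero by auto

section \<open>Nested links\<close>

text \<open>
  The innermost link \<open>\<Psi>(1) = y\<^sub>1 \<otimes> y\<^bsub>-1\<^esub> - v y\<^bsub>-1\<^esub> \<otimes> y\<^sub>1\<close>, which spans the image of each \<open>e\<^sub>i\<close> in its two
  tensor positions.
\<close>

definition cup :: "'a::field \<Rightarrow> 'a tens" where
  "cup v = Psi v (word [])"

lemma Psi_eq: "Psi v z = word [1] \<otimes> z \<otimes> word [- 1] - tscale v (word [- 1] \<otimes> z \<otimes> word [1])"
  by (simp add: Psi_def yvec_def)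

lemma cup_eq: "cup v = word [1, - 1] - tscale v (word [- 1, 1])"
  by (simp add: cup_def Psi_eq)

lemma Psi_homog: "z \<in> homog m 0 \<Longrightarrow> Psi v z \<in> homog (m + 2) 0"
proof -
  assume z: "z \<in> homog m 0"
  have "word [1] \<otimes> z \<otimes> word [- 1] \<in> homog (1 + (m + 1)) (1 + (0 + - 1))"
    "word [- 1] \<otimes> z \<otimes> word [1] \<in> homog (1 + (m + 1)) (- 1 + (0 + 1))"
    by (rule tensor_homog[OF _ tensor_homog[OF z]]; simp)+
  then show ?thesis unfolding Psi_eq
    by (simp add: tens.subspace_diff[OF subspace_homog] tens.subspace_scale[OF subspace_homog])
qed

lemma cup_homog: "cup v \<in> homog 2 0"
  using Psi_homog[of "word []" 0 v] by (simp add: cup_def numeral_2_eq_2)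

text \<open>
  The vector \<open>z\<close> is invariant (weight \<open>0\<close> and killed by \<open>F\<close>), so \<open>F\<close> passes over it. In the difference the
  terms \<open>F x \<otimes> y\<^sub>1 \<otimes> z \<otimes> y\<^sub>1\<close> cancel, and \<open>v\<^bsup>r+1\<^esup> + [r] = v [r + 1]\<close> makes the rest a multiple of \<open>x \<otimes> \<Psi>(z)\<close>.
\<close>

lemma tensor_Psi:
  assumes v: "v \<noteq> 0" and x: "x \<in> homog l r" and r: "0 \<le> r" and z: "z \<in> homog m 0" and Fz: "Fop v z = 0"
  shows "tscale (qint v (r + 1)) (x \<otimes> Psi v z) = Phi2 v (Phi1 x \<otimes> z) - Phi1 (Phi2 v x \<otimes> z)"
proof -
  have h: "Phi1 x \<otimes> z \<in> homog (Suc l + m) (r + 1 + 0)"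
    by (intro tensor_homog Phi1_homog x z)
  have F: "Fop v (Phi1 x \<otimes> z) = tscale (inverse v) (Fop v x \<otimes> word [1] \<otimes> z) + x \<otimes> word [- 1] \<otimes> z"
    using Fop_tensor[OF v z, of "x \<otimes> word [1]"] Fz
    by (simp add: Phi1_eq Fop_snoc tensor_bilinear tensor_assoc power_int_minus)
  have q: "qint v (r + 1) * v = v powi (r + 1) + qint v r"
    using qint_succ(1)[OF v r] v by (simp add: field_simps power_int_add)
  have p: "v powi (r + 1) * inverse v = v powi r" using v by (simp add: power_int_add)
  show ?thesis
    unfolding Phi2_eq[OF h] F
    unfolding Phi1_eq Phi2_eq[OF x] Psi_eq
    by (rule poly_mapping_eqI)
       (use q p in \<open>simp add: tensor_bilinear tensor_assoc lookup_add lookup_minus algebra_simps; algebra\<close>)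
qed

lemma tensor_cup:
  assumes "v \<noteq> 0" "x \<in> homog l r" "0 \<le> r"
  shows "tscale (qint v (r + 1)) (x \<otimes> cup v) = Phi2 v (Phi1 x) - Phi1 (Phi2 v x)"
  using tensor_Psi[OF assms, of "word []" 0] by (simp add: cup_def)

lemma mem_of_tscale_mem:
  assumes "tens.subspace S" "tscale c x \<in> S" "c \<noteq> 0" shows "x \<in> S"
  using tens.subspace_scale[OF assms(1,2), of "inverse c"] assms(3) by simp

section \<open>The decomposition of a 1-factor at its first entry\<close>

lemma sum_nth_atMost_take:
  assumes "j < length \<alpha>" shows "(\<Sum>k=0..j. \<alpha> ! k) = sum_list (take (Suc j) \<alpha>)"
proof -
  have "length (take (Suc j) \<alpha>) = Suc j" using assms by simp
  then show ?thesis by (simp add: sum_list_sum_nth flip: atLeastLessThanSuc_atLeastAtMost)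
qed

lemma pairing_0_iff:
  "pairing \<alpha> 0 j \<longleftrightarrow> 0 < j \<and> j < length \<alpha> \<and> \<alpha> ! 0 = 1 \<and> sum_list (take (Suc j) \<alpha>) = 0
     \<and> (\<forall>j'. 0 < j' \<and> j' < j \<longrightarrow> sum_list (take (Suc j') \<alpha>) \<noteq> 0)"
  unfolding pairing_def by (auto simp: sum_nth_atMost_take)

lemma pairing_0_unique: "pairing \<alpha> 0 j \<Longrightarrow> pairing \<alpha> 0 k \<Longrightarrow> j = k"
  unfolding pairing_0_iff by (metis nat_neq_iff)

text \<open>
  The recursion of \<open>\<eta>\<close> in terms of concatenation. If no partial sum returns to \<open>0\<close>, the entries
  after the first form a 1-factor. Otherwise the first return, at position \<open>j\<close>, is a step \<open>-1\<close>, and it cuts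
  \<open>\<alpha>\<close> into a balanced inner part and a part after it.
\<close>

lemma one_factor_eta_cases:
  assumes "one_factor \<alpha>"
  obtains (Nil) "\<alpha> = []"
  | (defect) \<beta> where "\<alpha> = 1 # \<beta>" "one_factor \<beta>" "\<And>v :: 'a::field. eta v \<alpha> = word [1] \<otimes> eta v \<beta>"
  | (pair) \<beta> \<gamma> where "\<alpha> = 1 # \<beta> @ - 1 # \<gamma>" "one_factor \<beta>" "sum_list \<beta> = 0" "one_factor \<gamma>"
      "\<And>v :: 'a::field. eta v \<alpha> = Psi v (eta v \<beta>) \<otimes> eta v \<gamma>"
proof (cases \<alpha>)
  case (Cons a \<delta>)
  have a: "a = 1"
    using assms one_factor_letters[OF assms] unfolding one_factor_def Cons
    by (auto dest!: spec[where x = 1])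
  have sums: "0 \<le> 1 + sum_list (take i \<delta>)" if "i \<le> length \<delta>" for i
    using assms that unfolding one_factor_def Cons a by (auto dest!: spec[where x = "Suc i"])
  have letters: "set \<delta> \<subseteq> {1, - 1}" using one_factor_letters[OF assms] Cons by auto
  show thesis
  proof (cases "defect \<alpha> 0")
    case True
    then have no: "\<not> pairing \<alpha> 0 j" for j by (auto simp: defect_def)
    have ne: "1 + sum_list (take i \<delta>) \<noteq> 0" if "i \<le> length \<delta>" for i
      using that
    proof (induction i rule: less_induct)
      case (less i)
      show ?case
      proof
        assume "1 + sum_list (take i \<delta>) = 0"
        then have "i > 0" by (cases i) auto
        with less \<open>1 + sum_list (take i \<delta>) = 0\<close> have "pairing \<alpha> 0 i"
          unfolding pairing_0_iff Cons a by auto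
        with no show False by blast
      qed
    qed
    have "0 \<le> sum_list (take i \<delta>)" if "i \<le> length \<delta>" for i
      using sums[OF that] ne[OF that] by linarith
    with letters have "one_factor \<delta>" by (auto simp: one_factor_def)
    moreover have "eta v \<alpha> = word [1] \<otimes> eta v \<delta>" for v :: 'a
      using True by (simp add: Cons yvec_def)
    ultimately show thesis using defect Cons a by blast
  next
    case False
    then obtain j where j: "pairing \<alpha> 0 j"
      by (auto simp: defect_def Cons pairing_def)
    then have the: "(THE j. pairing \<alpha> 0 j) = j" using pairing_0_unique by blast
    from j have j1: "0 < j" "j \<le> length \<delta>" "1 + sum_list (take j \<delta>) = 0"
      "\<And>k. 0 < k \<Longrightarrow> k < j \<Longrightarrow> 1 + sum_list (take k \<delta>) \<noteq> 0"
      unfolding pairing_0_iff Cons a by auto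
    define \<beta> \<gamma> where "\<beta> = take (j - 1) \<delta>" and "\<gamma> = drop j \<delta>"
    have split: "\<delta> = \<beta> @ \<delta> ! (j - 1) # \<gamma>"
      using j1 id_take_nth_drop[of "j - 1" \<delta>] by (simp add: \<beta>_def \<gamma>_def)
    \<comment> \<open>Before the first return the partial sums including the first entry stay at least 1.\<close>
    have inner: "0 \<le> sum_list (take k \<delta>)" if "k < j" for k
      using sums[of k] j1(4)[of k] j1(2) that by (cases "k = 0") auto
    have sumj: "sum_list (take j \<delta>) = sum_list \<beta> + \<delta> ! (j - 1)"
      using j1 take_Suc_conv_app_nth[of "j - 1" \<delta>] by (simp add: \<beta>_def)
    have "\<delta> ! (j - 1) \<in> {1, - 1}" 
      using j1(1,2) by (intro subsetD[OF letters] nth_mem) simp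
    moreover have "0 \<le> sum_list \<beta>" using inner[of "j - 1"] j1 by (simp add: \<beta>_def)
    ultimately have last: "\<delta> ! (j - 1) = - 1" and sum\<beta>: "sum_list \<beta> = 0"
      using sumj j1(3) by auto
    have "0 \<le> sum_list (take i \<beta>)" if "i \<le> length \<beta>" for i
    proof -
      have "i \<le> j - 1" using that by (simp add: \<beta>_def)
      with inner[of i] j1(1) show ?thesis by (simp add: \<beta>_def min_def)
    qed
    moreover have "set \<beta> \<subseteq> {1, - 1}" using letters set_take_subset[of "j - 1" \<delta>] by (auto simp: \<beta>_def)
    ultimately have "one_factor \<beta>" by (simp add: one_factor_def)
    moreover have "one_factor \<gamma>"
    proof -
      have "0 \<le> sum_list (take i \<gamma>)" if "i \<le> length \<gamma>" for i
      proof -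
        have "j + i \<le> length \<delta>" using that j1(2) by (simp add: \<gamma>_def)
        from sums[OF this] j1(3) show ?thesis by (simp add: \<gamma>_def take_add)
      qed
      moreover have "set \<gamma> \<subseteq> {1, - 1}" using letters set_drop_subset[of j \<delta>] by (auto simp: \<gamma>_def)
      ultimately show ?thesis by (simp add: one_factor_def)
    qed
    moreover have "eta v \<alpha> = Psi v (eta v \<beta>) \<otimes> eta v \<gamma>" for v :: 'a
      using False the by (simp add: Cons Let_def \<beta>_def \<gamma>_def)
    moreover have "\<alpha> = 1 # \<beta> @ - 1 # \<gamma>" using split last Cons a by simp
    ultimately show thesis using pair[of \<beta> \<gamma>] sum\<beta> by blast
  qed
qed (use Nil in simp)

lemma eta_induct [consumes 1, case_names Nil defect pair]:
  assumes "one_factor \<alpha>"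
    and "P []"
    and "\<And>\<beta>. one_factor \<beta> \<Longrightarrow> (\<And>v :: 'a::field. eta v (1 # \<beta>) = word [1] \<otimes> eta v \<beta>) \<Longrightarrow> P \<beta> \<Longrightarrow> P (1 # \<beta>)"
    and "\<And>\<beta> \<gamma>. one_factor \<beta> \<Longrightarrow> sum_list \<beta> = 0 \<Longrightarrow> one_factor \<gamma> \<Longrightarrow>
      (\<And>v :: 'a::field. eta v (1 # \<beta> @ - 1 # \<gamma>) = Psi v (eta v \<beta>) \<otimes> eta v \<gamma>) \<Longrightarrow>
      P \<beta> \<Longrightarrow> P \<gamma> \<Longrightarrow> P (1 # \<beta> @ - 1 # \<gamma>)"
  shows "P \<alpha>"
  using assms(1)
proof (induction "length \<alpha>" arbitrary: \<alpha> rule: less_induct)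
  case less
  from less.prems show ?case
  proof (cases rule: one_factor_eta_cases[where 'a = 'a])
    case Nil then show ?thesis using assms(2) by simp
  next
    case (defect \<beta>) then show ?thesis using assms(3)[of \<beta>] less.hyps[of \<beta>] by simp
  next
    case (pair \<beta> \<gamma>)
    then show ?thesis using assms(4)[of \<beta> \<gamma>] less.hyps[of \<beta>] less.hyps[of \<gamma>] by simp
  qed
qed

section \<open>The \<open>\<eta>\<close> lie in the span of the \<open>\<mu>\<close>\<close>

text \<open>
  The factor \<open>x\<close> on the left makes the induction work: a defect is absorbed into \<open>x\<close> by \<open>\<Phi>\<^sub>1\<close>, and a link
  \<open>\<Psi>(\<eta>(\<beta>))\<close> is resolved by the link formula into terms in which \<open>\<eta>(\<beta>)\<close> is multiplied by \<open>\<Phi>\<^sub>1(x)\<close> or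
  \<open>\<Phi>\<^sub>2(x)\<close>. The division by \<open>[r + 1]\<close> is harmless since \<open>r + 1 \<le> l + 1 \<le> n\<close>.
\<close>

lemma mu_span_tensor_eta:
  fixes v :: "'a::field"
  assumes v: "v \<noteq> 0" and n: "qfact v n \<noteq> 0" and "one_factor \<alpha>"
    and "x \<in> mu_span v l r" and "l + length \<alpha> \<le> n"
  shows "x \<otimes> eta v \<alpha> \<in> mu_span v (l + length \<alpha>) (r + sum_list \<alpha>)"
  using assms(3-)
proof (induction \<alpha> arbitrary: x l r rule: eta_induct[where 'a = 'a])
  case (defect \<beta>)
  have "Phi1 x \<otimes> eta v \<beta> \<in> mu_span v (Suc l + length \<beta>) (r + 1 + sum_list \<beta>)"
    using defect.prems by (intro defect.IH Phi1_mu_span) auto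
  then show ?case by (simp add: defect.hyps(2) Phi1_eq tensor_assoc add_ac del: eta.simps)
next
  case (pair \<beta> \<gamma>)
  let ?z = "eta v \<beta>"
  \<comment> \<open>The inner part lies in the span in weight 0, hence it is killed by F.\<close>
  have z: "?z \<in> mu_span v (length \<beta>) 0"
    using pair.IH(1)[of "word []" 0 0] pair.prems pair.hyps(2) mu_in_mu_span[of "[]" v] by simp
  have Psi: "x \<otimes> Psi v ?z \<in> mu_span v (l + length \<beta> + 2) r"
  proof (cases "0 \<le> r \<and> r \<le> int l")
    case False
    then have "x = 0" using mu_span_trivial pair.prems by blast
    then show ?thesis by (simp add: tensor_bilinear tens.subspace_0 subspace_mu_span)
  next
    case True
    have "Phi2 v (Phi1 x \<otimes> ?z) \<in> mu_span v (Suc (Suc l + length \<beta>)) (r + 1 + sum_list \<beta> - 1)"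
      using pair.prems by (intro Phi2_mu_span v pair.IH(1) Phi1_mu_span) auto
    moreover have "Phi1 (Phi2 v x \<otimes> ?z) \<in> mu_span v (Suc (Suc l + length \<beta>)) (r - 1 + sum_list \<beta> + 1)"
      using pair.prems by (intro Phi2_mu_span v pair.IH(1) Phi1_mu_span) auto
    ultimately have "tscale (qint v (r + 1)) (x \<otimes> Psi v ?z) \<in> mu_span v (l + length \<beta> + 2) r"
      using tensor_Psi[OF v mu_span_homog[OF pair.prems(1)] _ mu_span_homog[OF z] Fop_mu_span_zero[OF v z]]
        True pair.hyps(2)
      by (simp add: tens.subspace_diff[OF subspace_mu_span])
    moreover have "qint v (r + 1) \<noteq> 0"
      using qint_nonzero[OF n] True pair.prems by auto
    ultimately show ?thesis by (rule mem_of_tscale_mem[OF subspace_mu_span])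
  qed
  have "(x \<otimes> Psi v ?z) \<otimes> eta v \<gamma> \<in> mu_span v (l + length \<beta> + 2 + length \<gamma>) (r + sum_list \<gamma>)"
    using pair.prems by (intro pair.IH(2) Psi) auto
  then show ?case by (simp add: pair.hyps tensor_assoc add_ac del: eta.simps)
qed simp

lemma eta_in_mu_span:
  assumes "v \<noteq> 0" "qfact v n \<noteq> 0" "one_factor \<alpha>" "length \<alpha> \<le> n"
  shows "eta v \<alpha> \<in> mu_span v (length \<alpha>) (sum_list \<alpha>)"
  using mu_span_tensor_eta[OF assms(1-3), of "word []" 0 0] assms(4) mu_in_mu_span[of "[]" v] by simp


section \<open>The order on words\<close>

text \<open>
  The partial sums as a function, extended constantly beyond the end of the word. For words of equal
  length the order on sequences is then the pointwise order on functions, so that facts about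
  partial orders apply.
\<close>

definition height :: "int list \<Rightarrow> nat \<Rightarrow> int" where
  "height w j = sum_list (take j w)"

lemma one_factor_le_height: "one_factor_le w \<alpha> \<longleftrightarrow> length w = length \<alpha> \<and> height w \<le> height \<alpha>"
proof -
  have "height w j \<le> height \<alpha> j"
    if "length w = length \<alpha>" "\<forall>j\<le>length \<alpha>. height w j \<le> height \<alpha> j" for j
    using that(2)[rule_format, of "length \<alpha>"] that by (cases "j \<le> length \<alpha>") (auto simp: height_def)
  then show ?thesis by (auto simp: one_factor_le_def le_fun_def height_def)
qed

lemma height_inj: "length w = length \<alpha> \<Longrightarrow> height w = height \<alpha> \<Longrightarrow> w = \<alpha>"
proof (rule nth_equalityI)
  fix i assume *: "length w = length \<alpha>" "height w = height \<alpha>" "i < length w"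
  have "height x (Suc i) = height x i + x ! i" if "i < length x" for x
    using that by (simp add: height_def take_Suc_conv_app_nth)
  from this[of w] this[of \<alpha>] show "w ! i = \<alpha> ! i" using * by simp
qed

lemma one_factor_le_refl [simp]: "one_factor_le \<alpha> \<alpha>"
  by (simp add: one_factor_le_def)

lemma one_factor_le_trans: "one_factor_le \<alpha> \<beta> \<Longrightarrow> one_factor_le \<beta> \<gamma> \<Longrightarrow> one_factor_le \<alpha> \<gamma>"
  by (auto simp: one_factor_le_height)

lemma one_factor_le_antisym: "one_factor_le \<alpha> \<beta> \<Longrightarrow> one_factor_le \<beta> \<alpha> \<Longrightarrow> \<alpha> = \<beta>"
  by (auto simp: one_factor_le_height intro: height_inj)

lemma one_factor_le_append:
  "one_factor_le u \<alpha> \<Longrightarrow> one_factor_le w \<beta> \<Longrightarrow> one_factor_le (u @ w) (\<alpha> @ \<beta>)"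
  by (auto simp: one_factor_le_height le_fun_def height_def intro!: add_mono)

lemma one_factor_le_snoc:
  "one_factor_le (w @ [s]) (\<alpha> @ [a]) \<longleftrightarrow> one_factor_le w \<alpha> \<and> sum_list w + s \<le> sum_list \<alpha> + a"
  by (auto simp: one_factor_le_def le_Suc_eq)

lemma one_factor_le_sum: "one_factor_le w \<alpha> \<Longrightarrow> sum_list w \<le> sum_list \<alpha>"
  unfolding one_factor_le_def by (metis order_refl take_all)

section \<open>Leading words\<close>

definition below :: "int list \<Rightarrow> 'a::field tens set" where
  "below \<alpha> = {x. \<forall>w\<in>Poly_Mapping.keys x. one_factor_le w \<alpha>}"

text \<open>
  The word \<open>\<alpha>\<close> is the greatest word in the support of \<open>x\<close>.
\<close>

definition led_by :: "int list \<Rightarrow> 'a::field tens \<Rightarrow> bool" where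
  "led_by \<alpha> x \<longleftrightarrow> x \<in> below \<alpha> \<and> Poly_Mapping.lookup x \<alpha> \<noteq> 0"

lemma belowD: "x \<in> below \<alpha> \<Longrightarrow> w \<in> Poly_Mapping.keys x \<Longrightarrow> one_factor_le w \<alpha>"
  by (simp add: below_def)

lemma below_length: "x \<in> below \<alpha> \<Longrightarrow> w \<in> Poly_Mapping.keys x \<Longrightarrow> length w = length \<alpha>"
  by (auto dest: belowD simp: one_factor_le_def)

lemma subspace_below: "tens.subspace (below \<alpha>)"
  unfolding below_def by (rule subspace_support)

lemma keys_tensorE:
  assumes "t \<in> Poly_Mapping.keys (x \<otimes> y)"
  obtains u w where "t = u @ w" "u \<in> Poly_Mapping.keys x" "w \<in> Poly_Mapping.keys y"
proof -
  let ?P = "\<lambda>t. \<exists>u\<in>Poly_Mapping.keys x. \<exists>w\<in>Poly_Mapping.keys y. t = u @ w"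
  have "x \<otimes> y \<in> {z. \<forall>t\<in>Poly_Mapping.keys z. ?P t}"
  proof (rule tlinear_image_subspace[OF tlinear_tensor_left subspace_support])
    fix u assume u: "u \<in> Poly_Mapping.keys x"
    show "word u \<otimes> y \<in> {z. \<forall>t\<in>Poly_Mapping.keys z. ?P t}"
      by (rule tlinear_image_subspace[OF tlinear_tensor_right subspace_support]) (use u in auto)
  qed
  with assms that show thesis by blast
qed

lemma tensor_below: "x \<in> below \<alpha> \<Longrightarrow> y \<in> below \<beta> \<Longrightarrow> x \<otimes> y \<in> below (\<alpha> @ \<beta>)"
  unfolding below_def by (auto elim!: keys_tensorE intro: one_factor_le_append)

lemma lookup_tensor_word:
  "length u' = length u \<Longrightarrow>
    Poly_Mapping.lookup (word u' \<otimes> y) (u @ w) = (if u' = u then Poly_Mapping.lookup y w else 0)"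
proof -
  assume len: "length u' = length u"
  have "tscale (Poly_Mapping.lookup (word u' \<otimes> y) (u @ w)) (word []) =
    tscale (if u' = u then Poly_Mapping.lookup y w else 0) (word [] :: 'a tens)"
    by (rule tlinear_eq_on_words[where x = y])
       (use len in \<open>auto simp: tlinear_iff lookup_add tensor_bilinear tens.scale_left_distrib lookup_word\<close>)
  from arg_cong[OF this, of "\<lambda>x. Poly_Mapping.lookup x []"] show ?thesis
    by (simp add: lookup_word)
qed

lemma lookup_tensor:
  assumes "\<And>u'. u' \<in> Poly_Mapping.keys x \<Longrightarrow> length u' = length u"
  shows "Poly_Mapping.lookup (x \<otimes> y) (u @ w) = Poly_Mapping.lookup x u * Poly_Mapping.lookup y w"
proof -
  have "tscale (Poly_Mapping.lookup (x \<otimes> y) (u @ w)) (word []) =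
    tscale (Poly_Mapping.lookup x u * Poly_Mapping.lookup y w) (word [] :: 'a tens)"
    by (rule tlinear_eq_on_words[where x = x])
       (use assms in \<open>auto simp: tlinear_iff lookup_add tensor_bilinear tens.scale_left_distrib
          lookup_word lookup_tensor_word algebra_simps\<close>)
  from arg_cong[OF this, of "\<lambda>x. Poly_Mapping.lookup x []"] show ?thesis
    by (simp add: lookup_word)
qed

lemma led_by_tensor:
  assumes "led_by \<alpha> x" "led_by \<beta> y" shows "led_by (\<alpha> @ \<beta>) (x \<otimes> y)"
proof -
  have "Poly_Mapping.lookup (x \<otimes> y) (\<alpha> @ \<beta>) = Poly_Mapping.lookup x \<alpha> * Poly_Mapping.lookup y \<beta>"
    using assms(1) by (intro lookup_tensor) (auto simp: led_by_def dest: below_length)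
  then show ?thesis using assms by (simp add: led_by_def tensor_below)
qed

lemma led_by_word: "led_by w (word w)"
  by (simp add: led_by_def below_def lookup_word)

text \<open>
  Choosing \<open>y\<^sub>1\<close> at the left end of the link and \<open>y\<^bsub>-1\<^esub>\<close> at its right end gives the leading word. The other
  choice lowers every partial sum in between and starts with a different letter.
\<close>

lemma led_by_Psi:
  assumes "led_by \<beta> z" shows "led_by (1 # \<beta> @ [- 1]) (Psi v z)"
proof -
  have "led_by ([1] @ \<beta> @ [- 1]) (word [1] \<otimes> z \<otimes> word [- 1])"
    by (intro led_by_tensor led_by_word assms)
  moreover have low: "word [- 1] \<otimes> z \<otimes> word [1] \<in> below (1 # \<beta> @ [- 1])"
  proof -
    have "one_factor_le (- 1 # u @ [1]) (1 # \<beta> @ [- 1])" if "u \<in> Poly_Mapping.keys z" for u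
    proof -
      have u: "one_factor_le u \<beta>" using that assms by (auto simp: led_by_def dest: belowD)
      have "one_factor_le ([- 1] @ u) ([1] @ \<beta>)"
        by (rule one_factor_le_append[OF _ u]) (auto simp: one_factor_le_def take_Cons')
      then show ?thesis
        using one_factor_le_snoc[of "- 1 # u" 1 "1 # \<beta>" "- 1"] one_factor_le_sum[OF u] by simp
    qed
    then show ?thesis
      unfolding below_def by (auto elim!: keys_tensorE)
  qed
  moreover have "Poly_Mapping.lookup (word [- 1] \<otimes> z \<otimes> word [1]) ([1] @ \<beta> @ [- 1]) = 0"
    by (subst lookup_tensor_word) auto
  ultimately show ?thesis
    unfolding led_by_def Psi_eq
    by (auto simp: lookup_minus tens.subspace_diff[OF subspace_below] tens.subspace_scale[OF subspace_below])
qed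

lemma eta_led_by: "one_factor \<alpha> \<Longrightarrow> led_by \<alpha> (eta v \<alpha>)" for v :: "'a::field"
proof (induction \<alpha> rule: eta_induct[where 'a = 'a])
  case (defect \<beta>)
  then show ?case
    using led_by_tensor[OF led_by_word[of "[1]"] defect.IH] by (simp del: eta.simps)
next
  case (pair \<beta> \<gamma>)
  then show ?case
    using led_by_tensor[OF led_by_Psi[OF pair.IH(1)] pair.IH(2)] by (simp del: eta.simps)
qed (simp add: led_by_word)

text \<open>
  \<open>F\<close> turns one letter \<open>1\<close> into \<open>-1\<close>, and this lowers partial sums.
\<close>

lemma Fop_below: "x \<in> below \<alpha> \<Longrightarrow> Fop v x \<in> below \<alpha>"
proof (rule tlinear_image_subspace[OF tlinear_Fop subspace_below])
  fix w assume "x \<in> below \<alpha>" "w \<in> Poly_Mapping.keys x"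
  then have le: "one_factor_le w \<alpha>" by (rule belowD)
  have "Fop v (word w) \<in> below w"
  proof (induction w rule: rev_induct)
    case (snoc s w)
    have "word w \<otimes> F1 s \<in> below (w @ [s])"
      by (auto simp: F1_def yvec_def below_def one_factor_le_snoc tensor_bilinear)
    moreover have "Fop v (word w) \<otimes> word [s] \<in> below (w @ [s])"
      by (rule tensor_below[OF snoc.IH]) (simp add: below_def)
    ultimately show ?case
      unfolding Fop_word_snoc
      by (intro tens.subspace_add[OF subspace_below] tens.subspace_scale[OF subspace_below])
  qed (simp add: below_def)
  then show "Fop v (word w) \<in> below \<alpha>"
    using le by (auto simp: below_def intro: one_factor_le_trans)
qed

text \<open>
  The leading coefficient of \<open>\<mu>(\<alpha>)\<close> is the product of the \<open>[i]\<close> over the steps \<open>-1\<close> of \<open>\<alpha>\<close>, where \<open>i\<close> is the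
  partial sum before the step; each satisfies \<open>1 \<le> i \<le> n\<close>. The second term of \<open>\<Phi>\<^sub>2\<close> contributes only
  words that end in \<open>1\<close>, and \<open>F\<close> has lowered their last partial sum before that by \<open>2\<close>.
\<close>

lemma mu_led_by:
  assumes "v \<noteq> 0" "qfact v n \<noteq> 0"
  shows "one_factor \<alpha> \<Longrightarrow> length \<alpha> \<le> n \<Longrightarrow> led_by \<alpha> (mu v \<alpha>)"
proof (induction \<alpha> rule: rev_induct)
  case (snoc a \<alpha>)
  then have \<alpha>: "one_factor \<alpha>" and a: "a = 1 \<or> a = - 1" "0 \<le> sum_list \<alpha> + a"
    by (auto simp: one_factor_snoc)
  with snoc have IH: "led_by \<alpha> (mu v \<alpha>)" by simp
  show ?case
  proof (cases "a = 1")
    case True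
    then show ?thesis using led_by_tensor[OF IH led_by_word[of "[1]"]] by (simp add: mu_snoc Phi1_eq)
  next
    case False
    with a have a: "a = - 1" and r: "1 \<le> sum_list \<alpha>" by auto
    let ?x = "mu v \<alpha>"
    have x: "?x \<in> homog (length \<alpha>) (sum_list \<alpha>)" using mu_homog one_factor_letters[OF \<alpha>] .
    have q: "qint v (sum_list \<alpha>) \<noteq> 0"
      using qint_nonzero[OF assms(2) r] one_factor_sum_le_length[OF one_factor_letters[OF \<alpha>]] snoc.prems
      by auto
    have "led_by (\<alpha> @ [- 1]) (?x \<otimes> word [- 1])"
      by (intro led_by_tensor IH led_by_word)
    moreover have "Fop v ?x \<otimes> word [1] \<in> below (\<alpha> @ [- 1])"
    proof -
      have "one_factor_le (u @ [1]) (\<alpha> @ [- 1])" if "u \<in> Poly_Mapping.keys (Fop v ?x)" for u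
        using that homogD[OF Fop_homog[OF x] that] IH belowD[OF Fop_below]
        by (auto simp: led_by_def one_factor_le_snoc)
      then show ?thesis
        unfolding below_def by (auto elim!: keys_tensorE)
    qed
    moreover have "Poly_Mapping.lookup (Fop v ?x \<otimes> word [1]) (\<alpha> @ [- 1]) = 0"
      by (subst lookup_tensor) (auto simp: lookup_word dest: homogD[OF Fop_homog[OF x]])
    ultimately show ?thesis
      using q unfolding led_by_def a mu_snoc Phi2_eq[OF x]
      by (auto simp: lookup_minus tens.subspace_diff[OF subspace_below] tens.subspace_scale[OF subspace_below])
  qed
qed (simp add: led_by_word)

section \<open>Families with distinct leading words\<close>

lemma maximal_above:
  assumes "finite S" "\<beta>\<^sub>0 \<in> S" "\<And>\<beta>. \<beta> \<in> S \<Longrightarrow> length \<beta> = l"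
  shows "\<exists>\<beta>\<in>S. one_factor_le \<beta>\<^sub>0 \<beta> \<and> (\<forall>\<gamma>\<in>S. one_factor_le \<beta> \<gamma> \<longrightarrow> \<gamma> = \<beta>)"
proof -
  obtain m where m: "m \<in> height ` S" "height \<beta>\<^sub>0 \<le> m" "\<forall>b\<in>height ` S. m \<le> b \<longrightarrow> m = b"
    using finite_has_maximal2[of "height ` S" "height \<beta>\<^sub>0"] assms by auto
  then obtain \<beta> where "\<beta> \<in> S" "m = height \<beta>" by auto
  with m assms(2,3) show ?thesis
    by (intro bexI[of _ \<beta>]) (auto simp: one_factor_le_height intro!: height_inj)
qed

text \<open>
  If \<open>\<beta>\<close> is maximal among the indices with nonzero scalar, no other member of the family contains the
  word \<open>\<beta>\<close>, so its coefficient cannot cancel.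
\<close>

lemma leading_coefficient:
  assumes "finite I" "\<And>\<beta>. \<beta> \<in> I \<Longrightarrow> length \<beta> = l" "\<And>\<beta>. \<beta> \<in> I \<Longrightarrow> led_by \<beta> (f \<beta>)"
    and "\<beta>\<^sub>0 \<in> I" "c \<beta>\<^sub>0 \<noteq> 0"
  obtains \<beta> where "\<beta> \<in> I" "one_factor_le \<beta>\<^sub>0 \<beta>"
    "Poly_Mapping.lookup (\<Sum>\<gamma>\<in>I. tscale (c \<gamma>) (f \<gamma>)) \<beta> \<noteq> 0"
proof -
  let ?S = "{\<beta>\<in>I. c \<beta> \<noteq> 0}"
  have S: "finite ?S" "\<beta>\<^sub>0 \<in> ?S" "\<And>\<beta>. \<beta> \<in> ?S \<Longrightarrow> length \<beta> = l"
    using assms(1,2,4,5) by simp_all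
  obtain \<beta> where "\<beta> \<in> ?S" and le: "one_factor_le \<beta>\<^sub>0 \<beta>"
    and max: "\<forall>\<gamma>\<in>?S. one_factor_le \<beta> \<gamma> \<longrightarrow> \<gamma> = \<beta>"
    using maximal_above[OF S] by blast
  then have \<beta>: "\<beta> \<in> I" "c \<beta> \<noteq> 0" by simp_all
  have only: "c \<gamma> * Poly_Mapping.lookup (f \<gamma>) \<beta> = (if \<gamma> = \<beta> then c \<beta> * Poly_Mapping.lookup (f \<beta>) \<beta> else 0)"
    if "\<gamma> \<in> I" for \<gamma>
  proof (cases "c \<gamma> = 0 \<or> Poly_Mapping.lookup (f \<gamma>) \<beta> = 0")
    case True then show ?thesis by auto
  next
    case False
    then have "one_factor_le \<beta> \<gamma>"
      using belowD[of "f \<gamma>" \<gamma> \<beta>] assms(3)[OF that] by (simp add: led_by_def in_keys_iff)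
    with max that False have "\<gamma> = \<beta>" by blast
    then show ?thesis by simp
  qed
  have "Poly_Mapping.lookup (\<Sum>\<gamma>\<in>I. tscale (c \<gamma>) (f \<gamma>)) \<beta> =
      (\<Sum>\<gamma>\<in>I. if \<gamma> = \<beta> then c \<beta> * Poly_Mapping.lookup (f \<beta>) \<beta> else 0)"
    unfolding lookup_sum lookup_tscale using only by (rule sum.cong[OF refl])
  also have "\<dots> = c \<beta> * Poly_Mapping.lookup (f \<beta>) \<beta>"
    using assms(1) \<beta>(1) by simp
  finally have "Poly_Mapping.lookup (\<Sum>\<gamma>\<in>I. tscale (c \<gamma>) (f \<gamma>)) \<beta> = c \<beta> * Poly_Mapping.lookup (f \<beta>) \<beta>" .
  moreover have "Poly_Mapping.lookup (f \<beta>) \<beta> \<noteq> 0" using assms(3)[OF \<beta>(1)] by (simp add: led_by_def)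
  ultimately show thesis using that[OF \<beta>(1) le] \<beta>(2) by simp
qed

lemma led_family_scalars_zero:
  assumes "finite I" "\<And>\<beta>. \<beta> \<in> I \<Longrightarrow> length \<beta> = l" "\<And>\<beta>. \<beta> \<in> I \<Longrightarrow> led_by \<beta> (f \<beta>)"
    and "(\<Sum>\<gamma>\<in>I. tscale (c \<gamma>) (f \<gamma>)) = 0" "\<beta> \<in> I"
  shows "c \<beta> = 0"
proof (rule ccontr)
  assume "c \<beta> \<noteq> 0"
  from leading_coefficient[where f = f and c = c, OF assms(1-3,5) this] assms(4) show False
    by auto
qed

lemma led_family_below:
  assumes "finite I" "\<And>\<beta>. \<beta> \<in> I \<Longrightarrow> length \<beta> = l" "\<And>\<beta>. \<beta> \<in> I \<Longrightarrow> led_by \<beta> (f \<beta>)"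
    and "(\<Sum>\<gamma>\<in>I. tscale (c \<gamma>) (f \<gamma>)) \<in> below \<alpha>" "\<beta> \<in> I" "c \<beta> \<noteq> 0"
  shows "one_factor_le \<beta> \<alpha>"
proof -
  obtain \<gamma> where "one_factor_le \<beta> \<gamma>" "Poly_Mapping.lookup (\<Sum>\<gamma>\<in>I. tscale (c \<gamma>) (f \<gamma>)) \<gamma> \<noteq> 0"
    using leading_coefficient[where f = f and c = c, OF assms(1-3,5,6)] by metis
  with belowD[OF assms(4)] show ?thesis by (auto simp: in_keys_iff intro: one_factor_le_trans)
qed

lemma led_family_inj:
  assumes "\<And>\<beta>. \<beta> \<in> I \<Longrightarrow> led_by \<beta> (f \<beta>)"
  shows "inj_on f I"
proof (rule inj_onI)
  fix \<beta> \<gamma> assume "\<beta> \<in> I" "\<gamma> \<in> I" "f \<beta> = f \<gamma>"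
  then show "\<beta> = \<gamma>"
    using assms[of \<beta>] assms[of \<gamma>] belowD[of "f \<beta>" \<gamma> \<beta>] belowD[of "f \<beta>" \<beta> \<gamma>]
    by (auto simp: led_by_def in_keys_iff intro: one_factor_le_antisym)
qed

lemma led_family_independent:
  assumes "finite I" "\<And>\<beta>. \<beta> \<in> I \<Longrightarrow> length \<beta> = l" "\<And>\<beta>. \<beta> \<in> I \<Longrightarrow> led_by \<beta> (f \<beta>)"
  shows "tens.independent (f ` I)"
proof (rule tens.independent_if_scalars_zero)
  fix g x assume 0: "(\<Sum>x\<in>f ` I. tscale (g x) x) = 0" and "x \<in> f ` I"
  then obtain \<beta> where \<beta>: "\<beta> \<in> I" "x = f \<beta>" by auto
  have "(\<Sum>\<gamma>\<in>I. tscale (g (f \<gamma>)) (f \<gamma>)) = 0"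
    using 0 by (simp add: sum.reindex[OF led_family_inj[OF assms(3)]])
  from led_family_scalars_zero[where f = f and c = "\<lambda>\<gamma>. g (f \<gamma>)", OF assms this \<beta>(1)] \<beta> show "g x = 0" by simp
qed (use assms in simp)

lemma span_family_coefficients:
  assumes "finite I" "x \<in> tens.span (f ` I)"
  obtains c where "x = (\<Sum>i\<in>I. tscale (c i) (f i))"
proof -
  have "\<exists>c. x = (\<Sum>i\<in>I. tscale (c i) (f i))"
    using assms(2)
  proof (induction rule: tens.span_induct_alt)
    case base
    then show ?case by (intro exI[of _ "\<lambda>_. 0"]) simp
  next
    case (step k x y)
    then obtain i c where i: "i \<in> I" "x = f i" and c: "y = (\<Sum>i\<in>I. tscale (c i) (f i))" by auto
    have "tscale k x = (\<Sum>j\<in>I. tscale (if j = i then k else 0) (f j))"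
      using assms(1) i by (simp add: if_distrib[of "\<lambda>k. tscale k _"] cong: if_cong)
    then show ?case
      by (intro exI[of _ "\<lambda>j. (if j = i then k else 0) + c j"])
         (simp add: c tens.scale_left_distrib sum.distrib)
  qed
  then show thesis using that by blast
qed

text \<open>
  Counting: a vector of the second family outside the span of the first would make an independent set
  with more than \<open>card I\<close> elements inside a space spanned by \<open>card I\<close> vectors.
\<close>

lemma span_eq_of_led_families:
  assumes "finite I" "\<And>\<beta>. \<beta> \<in> I \<Longrightarrow> length \<beta> = l"
    and f: "\<And>\<beta>. \<beta> \<in> I \<Longrightarrow> led_by \<beta> (f \<beta>)"
    and sub: "f ` I \<subseteq> tens.span (g ` I)"
  shows "tens.span (f ` I) = tens.span (g ` I)"
proof
  show "tens.span (f ` I) \<subseteq> tens.span (g ` I)"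
    using sub by (simp add: tens.span_minimal)
  have "x \<in> tens.span (f ` I)" if "x \<in> g ` I" for x
  proof (rule ccontr)
    assume x: "x \<notin> tens.span (f ` I)"
    with led_family_independent[where f = f, OF assms(1-3)] have "tens.independent (insert x (f ` I))"
      by (simp add: tens.independent_insert)
    moreover have "insert x (f ` I) \<subseteq> tens.span (g ` I)"
      using sub that by (auto intro: tens.span_base)
    ultimately have "card (insert x (f ` I)) \<le> card (g ` I)"
      using tens.independent_span_bound[of "g ` I"] assms(1) by blast
    moreover have "card (insert x (f ` I)) = Suc (card I)"
      using x tens.span_base[of x] assms(1) card_image[OF led_family_inj[where f = f, OF f]]
      by (subst card_insert_disjoint) auto
    moreover have "card (g ` I) \<le> card I" by (rule card_image_le[OF assms(1)])
    ultimately show False by simp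
  qed
  then show "tens.span (g ` I) \<subseteq> tens.span (f ` I)"
    by (intro tens.span_minimal) auto
qed

lemma transition_matrix_invertible:
  assumes fin: "finite I" and len: "\<And>\<beta>. \<beta> \<in> I \<Longrightarrow> length \<beta> = l"
    and f: "\<And>\<beta>. \<beta> \<in> I \<Longrightarrow> led_by \<beta> (f \<beta>)" and g: "\<And>\<beta>. \<beta> \<in> I \<Longrightarrow> led_by \<beta> (g \<beta>)"
    and P: "\<And>i. i \<in> I \<Longrightarrow> f i = (\<Sum>j\<in>I. tscale (P i j) (g j))"
  shows "invertible_on I P"
proof -
  have "f ` I \<subseteq> tens.span (g ` I)"
    using P by (auto intro: tens.span_sum tens.span_scale tens.span_base)
  then have "tens.span (f ` I) = tens.span (g ` I)"
    by (intro span_eq_of_led_families[where f = f, OF fin len f]) auto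
  then have "\<exists>c. g i = (\<Sum>j\<in>I. tscale (c j) (f j))" if "i \<in> I" for i
    using that span_family_coefficients[OF fin, of "g i" f] by (metis imageI tens.span_base)
  then obtain Q where Q: "\<And>i. i \<in> I \<Longrightarrow> g i = (\<Sum>j\<in>I. tscale (Q i j) (f j))"
    by metis
  have product: "(\<Sum>j\<in>I. A i j * B j k) = (if i = k then 1 else 0)"
    if h: "\<And>\<beta>. \<beta> \<in> I \<Longrightarrow> led_by \<beta> (h \<beta>)" and "i \<in> I" "k \<in> I"
      and A: "h i = (\<Sum>j\<in>I. tscale (A i j) (h' j))"
      and B: "\<And>j. j \<in> I \<Longrightarrow> h' j = (\<Sum>k\<in>I. tscale (B j k) (h k))"
    for h h' :: "int list \<Rightarrow> 'a tens" and A B i k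
  proof -
    have "h i = (\<Sum>j\<in>I. \<Sum>k\<in>I. tscale (A i j * B j k) (h k))"
      by (simp add: A B tens.scale_sum_right)
    also have "\<dots> = (\<Sum>k\<in>I. tscale (\<Sum>j\<in>I. A i j * B j k) (h k))"
      by (subst sum.swap) (simp add: tens.scale_sum_left)
    finally have "(\<Sum>k\<in>I. tscale ((\<Sum>j\<in>I. A i j * B j k) - (if i = k then 1 else 0)) (h k)) = 0"
      using fin \<open>i \<in> I\<close>
      by (simp add: tens.scale_left_diff_distrib sum_subtractf if_distrib[of "\<lambda>k. tscale k _"] cong: if_cong)
    from led_family_scalars_zero[where f = h and c = "\<lambda>k. (\<Sum>j\<in>I. A i j * B j k) - (if i = k then 1 else 0)",
        OF fin len h this \<open>k \<in> I\<close>]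
    show ?thesis by (simp add: algebra_simps)
  qed
  show ?thesis
    unfolding invertible_on_def
  proof (intro exI[of _ Q] ballI conjI)
    fix i k assume ik: "i \<in> I" "k \<in> I"
    show "(\<Sum>j\<in>I. P i j * Q j k) = (if i = k then 1 else 0)"
      by (rule product[where h = f and h' = g and A = P and B = Q, OF f ik P[OF ik(1)] Q])
    show "(\<Sum>j\<in>I. Q i j * P j k) = (if i = k then 1 else 0)"
      by (rule product[where h = g and h' = f and A = Q and B = P, OF g ik Q[OF ik(1)] P])
  qed
qed


section \<open>The Temperley--Lieb action\<close>

text \<open>
  In its two tensor positions \<open>e\<^sub>i\<close> has rank one: it sends \<open>y\<^sub>a \<otimes> y\<^sub>b\<close> to this multiple of \<open>\<Psi>(1)\<close>.
\<close>

definition link_coeff :: "'a::field \<Rightarrow> int \<Rightarrow> int \<Rightarrow> 'a" where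
  "link_coeff v a b = (if a = 1 \<and> b = - 1 then - inverse v else if a = - 1 \<and> b = 1 then 1 else 0)"

lemma link_coeff_simps [simp]:
  "link_coeff v 1 1 = 0" "link_coeff v (- 1) (- 1) = 0"
  "link_coeff v 1 (- 1) = - inverse v" "link_coeff v (- 1) 1 = 1"
  by (simp_all add: link_coeff_def)

lemma e2_eq: "v \<noteq> 0 \<Longrightarrow> e2 v a b = tscale (link_coeff v a b) (cup v)"
  by (rule poly_mapping_eqI)
     (simp add: e2_def link_coeff_def cup_eq lookup_minus lookup_add field_simps)

lemma tlinear_tl_e: "tlinear (tl_e v i)"
  unfolding tl_e_def by (rule tlinear_linext)

lemma tlinear_tl_e_comp: "tlinear f \<Longrightarrow> tlinear (\<lambda>x. tl_e v i (f x))"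
  by (rule tlinear_compose[OF tlinear_tl_e])

text \<open>
  Every later computation with \<open>e\<^sub>i\<close> goes through this rule; it hides the positions in words. Since
  \<open>x\<close> has length \<open>k\<close>, the letters \<open>a\<close> and \<open>b\<close> stand in the positions \<open>k + 1\<close> and \<open>k + 2\<close>.
\<close>

lemma tl_e_letters:
  assumes v: "v \<noteq> 0" and x: "x \<in> homog k r"
  shows "tl_e v (Suc k) (x \<otimes> word [a, b] \<otimes> z) = tscale (link_coeff v a b) (x \<otimes> cup v \<otimes> z)"
proof (rule tlinear_eq_on_words[where x = x])
  fix u assume "u \<in> Poly_Mapping.keys x"
  then have u: "length u = k" using homogD[OF x] by blast
  show "tl_e v (Suc k) (word u \<otimes> word [a, b] \<otimes> z) = tscale (link_coeff v a b) (word u \<otimes> cup v \<otimes> z)"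
  proof (rule tlinear_eq_on_words[where x = z])
    fix w
    have "tl_e v (Suc k) (word (u @ a # b # w)) = word u \<otimes> e2 v a b \<otimes> word w"
      by (simp add: tl_e_def nth_append flip: u)
    then show "tl_e v (Suc k) (word u \<otimes> word [a, b] \<otimes> word w) =
        tscale (link_coeff v a b) (word u \<otimes> cup v \<otimes> word w)"
      by (simp add: e2_eq[OF v] tensor_bilinear)
  qed (intro tlinear_intros tlinear_tl_e_comp)+
qed (intro tlinear_intros tlinear_tl_e_comp)+

lemma tl_e_last_letters:
  assumes "v \<noteq> 0" "x \<in> homog k r"
  shows "tl_e v (Suc k) (x \<otimes> word [a, b]) = tscale (link_coeff v a b) (x \<otimes> cup v)"
  using tl_e_letters[OF assms, of a b "word []"] by simp

lemma word_split_at: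
  assumes "length w = l" "i \<in> {1..<l}"
  obtains k u a b t where "i = Suc k" "w = u @ [a, b] @ t" "length u = k"
proof -
  from assms obtain k where k: "i = Suc k" "Suc k < length w" by (cases i) auto
  then have "w = take k w @ [w ! k, w ! Suc k] @ drop (Suc (Suc k)) w"
    by (metis Cons_nth_drop_Suc Suc_lessD append_Cons append_Nil append_take_drop_id)
  with k show thesis by (intro that[of k "take k w"]) auto
qed

lemma tl_e_tensor:
  assumes v: "v \<noteq> 0" and x: "x \<in> homog l r" and i: "i \<in> {1..<l}"
  shows "tl_e v i (x \<otimes> z) = tl_e v i x \<otimes> z"
proof (rule tlinear_eq_on_words[where x = x])
  fix w assume w: "w \<in> Poly_Mapping.keys x"
  from homogD[OF x w] word_split_at[OF _ i] obtain k u a b t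
    where w: "i = Suc k" "w = u @ [a, b] @ t" "length u = k" and "set w \<subseteq> {1, - 1}" by metis
  then have u: "word u \<in> (homog k (sum_list u) :: 'a tens set)" by auto
  have split: "word w = word u \<otimes> word [a, b] \<otimes> word t" by (simp add: w(2))
  show "tl_e v i (word w \<otimes> z) = tl_e v i (word w) \<otimes> z"
    by (simp only: split w(1) tensor_assoc
        tl_e_letters[OF v u] tensor_bilinear)
qed (intro tlinear_intros tlinear_tl_e_comp)+

lemma tl_e_homog:
  assumes v: "v \<noteq> 0" and x: "x \<in> homog l r" and i: "i \<in> {1..<l}"
  shows "tl_e v i x \<in> homog l r"
proof (rule tlinear_image_subspace[OF tlinear_tl_e subspace_homog])
  fix w assume w: "w \<in> Poly_Mapping.keys x"
  from homogD[OF x w] word_split_at[OF _ i] obtain k u a b t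
    where w: "i = Suc k" "w = u @ [a, b] @ t" "length u = k" and s: "set w \<subseteq> {1, - 1}"
      and lr: "length w = l" "sum_list w = r" by metis
  then have u: "word u \<in> (homog k (sum_list u) :: 'a tens set)"
    and t: "word t \<in> (homog (length t) (sum_list t) :: 'a tens set)" by auto
  have h: "word u \<otimes> cup v \<otimes> word t \<in> homog (k + (2 + length t)) (sum_list u + (0 + sum_list t))"
    by (intro tensor_homog u t cup_homog)
  have "tl_e v i (word w) = tscale (link_coeff v a b) (word u \<otimes> cup v \<otimes> word t)"
    using tl_e_letters[OF v u, of a b "word t"] by (simp add: w)
  moreover have "tscale (link_coeff v a b) (word u \<otimes> cup v \<otimes> word t) \<in> homog l r"
  proof (cases "link_coeff v a b = 0")
    case False
    then have "a + b = 0" by (auto simp: link_coeff_def split: if_splits)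
    then have "r = sum_list u + (0 + sum_list t)" "l = k + (2 + length t)"
      using lr w by auto
    then show ?thesis using tens.subspace_scale[OF subspace_homog h] by simp
  qed (simp add: tens.subspace_0[OF subspace_homog])
  ultimately show "tl_e v i (word w) \<in> homog l r" by simp
qed

lemma Fop_cup: "v \<noteq> 0 \<Longrightarrow> Fop v (cup v) = 0"
  using Fop_word_snoc[of v "[1]" "- 1"] Fop_word_snoc[of v "[- 1]" 1]
  by (simp add: cup_eq tlinear_diff[OF tlinear_Fop] tlinear_scale[OF tlinear_Fop] Fop_letter tensor_bilinear)

lemma tl_e_Fop_letters:
  assumes v: "v \<noteq> 0" and x: "x \<in> homog k r" and ab: "a \<in> {1, - 1}" "b \<in> {1, - 1}"
  shows "tl_e v (Suc k) (x \<otimes> Fop v (word [a, b]) \<otimes> z) = 0"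
  using ab v Fop_word_snoc[of v "[a]" b]
  by (auto simp: Fop_letter tensor_bilinear tlinear_add[OF tlinear_tl_e] tlinear_scale[OF tlinear_tl_e]
      tlinear_zero[OF tlinear_tl_e] tl_e_letters[OF v x] power_int_minus simp flip: tens.scale_left_distrib)

text \<open>
  \<open>\<Psi>(1)\<close> is invariant under \<open>F\<close>, and \<open>e\<^sub>i\<close> kills the image of \<open>F\<close> on its two positions. The powers of \<open>v\<close>
  agree because \<open>e\<^sub>i\<close> is nonzero only on letter pairs of weight \<open>0\<close>.
\<close>

lemma tl_e_Fop:
  assumes v: "v \<noteq> 0" and x: "x \<in> homog l r" and i: "i \<in> {1..<l}"
  shows "tl_e v i (Fop v x) = Fop v (tl_e v i x)"
proof (rule tlinear_eq_on_words[where x = x])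
  fix w assume w: "w \<in> Poly_Mapping.keys x"
  from homogD[OF x w] word_split_at[OF _ i] obtain k u a b t
    where w: "i = Suc k" "w = u @ [a, b] @ t" "length u = k" and s: "set w \<subseteq> {1, - 1}" by metis
  then have u: "word u \<in> (homog k (sum_list u) :: 'a tens set)"
    and t: "word t \<in> (homog (length t) (sum_list t) :: 'a tens set)"
    and ab: "a \<in> {1, - 1}" "b \<in> {1, - 1}"
    and abt: "word [a, b] \<otimes> word t \<in> (homog (2 + length t) (a + b + sum_list t) :: 'a tens set)" by auto
  have Fu: "Fop v (word u) \<in> homog k (sum_list u - 2)" by (rule Fop_homog[OF u])
  have ct: "cup v \<otimes> word t \<in> homog (2 + length t) (0 + sum_list t)"
    by (intro tensor_homog cup_homog t)
  let ?s = "sum_list t" and ?T = "tl_e v (Suc k)"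
  have "Fop v (word w) = tscale (v powi (- (a + b + ?s))) (Fop v (word u) \<otimes> word [a, b] \<otimes> word t)
     + tscale (v powi (- ?s)) (word u \<otimes> Fop v (word [a, b]) \<otimes> word t)
     + word u \<otimes> word [a, b] \<otimes> Fop v (word t)"
    using Fop_tensor[OF v abt, of "word u"] Fop_tensor[OF v t, of "word [a, b]"]
    by (simp add: w tensor_bilinear add.assoc)
  then have "?T (Fop v (word w)) = tscale (link_coeff v a b)
      (tscale (v powi (- (a + b + ?s))) (Fop v (word u) \<otimes> cup v \<otimes> word t) + word u \<otimes> cup v \<otimes> Fop v (word t))"
    by (simp only: tlinear_add[OF tlinear_tl_e] tlinear_scale[OF tlinear_tl_e] tl_e_letters[OF v u]
        tl_e_letters[OF v Fu] tl_e_Fop_letters[OF v u ab] tens.scale_right_distrib)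
       (simp add: mult.commute)
  moreover have "Fop v (?T (word w)) = tscale (link_coeff v a b)
      (tscale (v powi (- ?s)) (Fop v (word u) \<otimes> cup v \<otimes> word t) + word u \<otimes> cup v \<otimes> Fop v (word t))"
    using tl_e_letters[OF v u, of a b "word t"] Fop_tensor[OF v ct, of "word u"] Fop_tensor[OF v t, of "cup v"]
    by (simp add: w Fop_cup[OF v] tensor_bilinear tlinear_scale[OF tlinear_Fop])
  moreover have "link_coeff v a b = 0 \<or> v powi (- (a + b + ?s)) = v powi (- ?s)"
    by (auto simp: link_coeff_def)
  ultimately show "tl_e v i (Fop v (word w)) = Fop v (tl_e v i (word w))" unfolding w(1) by auto
qed (intro tlinear_intros tlinear_tl_e_comp tlinear_Fop_comp)+

lemma tl_e_Phi1:
  assumes "v \<noteq> 0" "x \<in> homog l r" "i \<in> {1..<l}"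
  shows "tl_e v i (Phi1 x) = Phi1 (tl_e v i x)"
  by (simp add: Phi1_eq tl_e_tensor[OF assms])

lemma tl_e_Phi2:
  assumes "v \<noteq> 0" "x \<in> homog l r" "i \<in> {1..<l}"
  shows "tl_e v i (Phi2 v x) = Phi2 v (tl_e v i x)"
  unfolding Phi2_eq[OF assms(2)] Phi2_eq[OF tl_e_homog[OF assms]]
  by (simp add: tlinear_diff[OF tlinear_tl_e] tlinear_scale[OF tlinear_tl_e] tl_e_tensor[OF assms]
      tl_e_tensor[OF assms(1) Fop_homog[OF assms(2)] assms(3)] tl_e_Fop[OF assms])

section \<open>The Temperley--Lieb relations\<close>

lemma tl_e_cup:
  assumes v: "v \<noteq> 0" and x: "x \<in> homog k r"
  shows "tl_e v (Suc k) (x \<otimes> cup v \<otimes> z) = tscale (- (v + inverse v)) (x \<otimes> cup v \<otimes> z)"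
proof -
  have "tl_e v (Suc k) (x \<otimes> cup v \<otimes> z) =
      tscale (- inverse v) (x \<otimes> cup v \<otimes> z) - tscale v (x \<otimes> cup v \<otimes> z)"
    by (subst (1) cup_eq)
       (simp add: tensor_bilinear tlinear_diff[OF tlinear_tl_e] tlinear_scale[OF tlinear_tl_e]
         tl_e_letters[OF v x])
  then show ?thesis
    by (simp only:) (rule poly_mapping_eqI, simp add: lookup_minus algebra_simps)
qed

text \<open>
  This and the next rule move a link past a letter. They imply the relations \<open>e\<^sub>i e\<^sub>j e\<^sub>i = e\<^sub>i\<close> for
  \<open>|i - j| = 1\<close>, because \<open>e\<^sub>i\<close> has rank one with image spanned by the link.
\<close>

lemma tl_e_slide_left:
  assumes v: "v \<noteq> 0" and x: "x \<in> homog k r" and s: "s \<in> {1, - 1}"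
  shows "tl_e v (Suc k) (x \<otimes> word [s] \<otimes> cup v \<otimes> z) = x \<otimes> cup v \<otimes> word [s] \<otimes> z"
proof -
  have "x \<otimes> word [s] \<otimes> cup v \<otimes> z =
      x \<otimes> word [s, 1] \<otimes> word [- 1] \<otimes> z - tscale v (x \<otimes> word [s, - 1] \<otimes> word [1] \<otimes> z)"
    by (simp add: cup_eq tensor_bilinear flip: tensor_assoc)
  then show ?thesis
    using s v by (auto simp: tlinear_diff[OF tlinear_tl_e] tlinear_scale[OF tlinear_tl_e] tl_e_letters[OF v x])
qed

lemma tl_e_slide_right:
  assumes v: "v \<noteq> 0" and x: "x \<in> homog k r" and s: "s \<in> {1, - 1}"
  shows "tl_e v (Suc (Suc k)) (x \<otimes> cup v \<otimes> word [s] \<otimes> z) = x \<otimes> word [s] \<otimes> cup v \<otimes> z"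
proof -
  have y: "x \<otimes> word [c] \<in> homog (Suc k) (r + c)" if "c \<in> {1, - 1}" for c
    using tensor_homog[OF x word_homog[of "[c]" 1 c]] that by auto
  have act: "tl_e v (Suc (Suc k)) (x \<otimes> word [c] \<otimes> word [a, b] \<otimes> z) =
      tscale (link_coeff v a b) (x \<otimes> word [c] \<otimes> cup v \<otimes> z)" if "c \<in> {1, - 1}" for a b c
    using tl_e_letters[OF v y[OF that], of a b z] by (simp only: tensor_assoc)
  have "x \<otimes> cup v \<otimes> word [s] \<otimes> z =
      x \<otimes> word [1] \<otimes> word [- 1, s] \<otimes> z - tscale v (x \<otimes> word [- 1] \<otimes> word [1, s] \<otimes> z)"
    by (simp add: cup_eq tensor_bilinear flip: tensor_assoc)
  then show ?thesis
    using s v by (auto simp: tlinear_diff[OF tlinear_tl_e] tlinear_scale[OF tlinear_tl_e] act)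
qed

lemma tl_e_idempotent:
  assumes v: "v \<noteq> 0" and x: "x \<in> homog l r" and i: "i \<in> {1..<l}"
  shows "tl_e v i (tl_e v i x) = tscale (- (v + inverse v)) (tl_e v i x)"
proof (rule tlinear_eq_on_words[where x = x])
  fix w assume w: "w \<in> Poly_Mapping.keys x"
  from homogD[OF x w] word_split_at[OF _ i] obtain k u a b t
    where w: "i = Suc k" "w = u @ [a, b] @ t" "length u = k" and s: "set w \<subseteq> {1, - 1}" by metis
  then have u: "word u \<in> (homog k (sum_list u) :: 'a tens set)" by auto
  show "tl_e v i (tl_e v i (word w)) = tscale (- (v + inverse v)) (tl_e v i (word w))"
    using tl_e_letters[OF v u, of a b "word t"] tl_e_cup[OF v u, of "word t"]
    by (simp add: w tlinear_scale[OF tlinear_tl_e] mult.commute)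
qed (intro tlinear_intros tlinear_tl_e_comp)+

lemma tl_e_braid:
  assumes v: "v \<noteq> 0" and x: "x \<in> homog l r" and k: "Suc (Suc k) < l"
  shows "tl_e v (Suc k) (tl_e v (Suc (Suc k)) (tl_e v (Suc k) x)) = tl_e v (Suc k) x"
    and "tl_e v (Suc (Suc k)) (tl_e v (Suc k) (tl_e v (Suc (Suc k)) x)) = tl_e v (Suc (Suc k)) x"
proof -
  have *: "tl_e v (Suc k) (tl_e v (Suc (Suc k)) (tl_e v (Suc k) (word w))) = tl_e v (Suc k) (word w)
      \<and> tl_e v (Suc (Suc k)) (tl_e v (Suc k) (tl_e v (Suc (Suc k)) (word w))) = tl_e v (Suc (Suc k)) (word w)"
    if "w \<in> Poly_Mapping.keys x" for w
  proof -
    have s: "set w \<subseteq> {1, - 1}" "length w = l" using homogD[OF x that] by auto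
    have "Suc k \<in> {1..<l}" using k by simp
    then obtain u a b t where w: "w = u @ [a, b] @ t" "length u = k"
      using word_split_at[OF s(2)] by (metis Suc_inject)
    with k s obtain c t' where t: "t = c # t'" by (cases t) auto
    have u: "word u \<in> (homog k (sum_list u) :: 'a tens set)"
      and ua: "word (u @ [a]) \<in> (homog (Suc k) (sum_list (u @ [a])) :: 'a tens set)"
      and ac: "a \<in> {1, - 1}" "c \<in> {1, - 1}"
      using w s t by auto
    have 1: "tl_e v (Suc k) (word w) = tscale (link_coeff v a b) (word u \<otimes> cup v \<otimes> word [c] \<otimes> word t')"
      using tl_e_letters[OF v u, of a b "word t"] by (simp add: w t)
    have 2: "tl_e v (Suc (Suc k)) (word w) =
        tscale (link_coeff v b c) (word u \<otimes> word [a] \<otimes> cup v \<otimes> word t')"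
      using tl_e_letters[OF v ua, of b c "word t'"] by (simp add: w t flip: tensor_assoc)
    show ?thesis
      by (simp only: 1 2 tlinear_scale[OF tlinear_tl_e] tl_e_slide_left[OF v u ac(1)]
          tl_e_slide_left[OF v u ac(2)] tl_e_slide_right[OF v u ac(1)] tl_e_slide_right[OF v u ac(2)] simp_thms)
  qed
  show "tl_e v (Suc k) (tl_e v (Suc (Suc k)) (tl_e v (Suc k) x)) = tl_e v (Suc k) x"
    by (rule tlinear_eq_on_words[where x = x]) (use * in \<open>(intro tlinear_intros tlinear_tl_e_comp | simp)+\<close>)
  show "tl_e v (Suc (Suc k)) (tl_e v (Suc k) (tl_e v (Suc (Suc k)) x)) = tl_e v (Suc (Suc k)) x"
    by (rule tlinear_eq_on_words[where x = x]) (use * in \<open>(intro tlinear_intros tlinear_tl_e_comp | simp)+\<close>)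
qed

lemma tl_e_commute:
  assumes v: "v \<noteq> 0" and x: "x \<in> homog l r" and i: "i \<in> {1..<l}" and j: "j \<in> {1..<l}" and ij: "i + 1 < j"
  shows "tl_e v i (tl_e v j x) = tl_e v j (tl_e v i x)"
proof (rule tlinear_eq_on_words[where x = x])
  fix w assume w: "w \<in> Poly_Mapping.keys x"
  from homogD[OF x w] word_split_at[OF _ j] obtain m p c d t'
    where w: "j = Suc m" "w = p @ [c, d] @ t'" "length p = m" and s: "set w \<subseteq> {1, - 1}" by metis
  moreover have "i \<in> {1..<m}" using i ij w by auto
  ultimately obtain k u a b t where p: "i = Suc k" "p = u @ [a, b] @ t" "length u = k"
    using word_split_at[of p m i] by metis
  have u: "word u \<in> (homog k (sum_list u) :: 'a tens set)"
    and pw: "word p \<in> (homog m (sum_list p) :: 'a tens set)"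
    and t: "word t \<in> (homog (length t) (sum_list t) :: 'a tens set)" using w p s by auto
  have q: "word u \<otimes> cup v \<otimes> word t \<in> homog m (sum_list u + (0 + sum_list t))"
    using tensor_homog[OF u tensor_homog[OF cup_homog t]] w p by (simp add: add.assoc)
  have p': "word u \<otimes> word [a, b] \<otimes> word t = word p" by (simp add: p)
  have split: "word w = word u \<otimes> word [a, b] \<otimes> word t \<otimes> word [c, d] \<otimes> word t'"
    by (simp add: w p)
  have j1: "tl_e v j (word u \<otimes> word [a, b] \<otimes> word t \<otimes> word [c, d] \<otimes> word t') =
      tscale (link_coeff v c d) (word u \<otimes> word [a, b] \<otimes> word t \<otimes> cup v \<otimes> word t')"
    using tl_e_letters[OF v pw, of c d "word t'"] by (simp only: p'[symmetric] w(1) tensor_assoc)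
  have j2: "tl_e v j (word u \<otimes> cup v \<otimes> word t \<otimes> word [c, d] \<otimes> word t') =
      tscale (link_coeff v c d) (word u \<otimes> cup v \<otimes> word t \<otimes> cup v \<otimes> word t')"
    using tl_e_letters[OF v q, of c d "word t'"] by (simp only: w(1) tensor_assoc)
  show "tl_e v i (tl_e v j (word w)) = tl_e v j (tl_e v i (word w))"
    by (simp only: split j1 j2 p(1) tl_e_letters[OF v u] tlinear_scale[OF tlinear_tl_e]
        tens.scale_scale mult.commute)
qed (intro tlinear_intros tlinear_tl_e_comp)+


section \<open>The action on the \<open>\<mu>\<close>\<close>

text \<open>
  The recursion of \<open>\<mu>\<close> started at an arbitrary vector, used to follow the effect of \<open>e\<^sub>i\<close> on two
  letters in the middle of a 1-factor through the remaining steps.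
\<close>

definition mu_from :: "'a::field \<Rightarrow> 'a tens \<Rightarrow> int list \<Rightarrow> 'a tens" where
  "mu_from v x \<delta> = foldl (\<lambda>b a. if a = 1 then Phi1 b else Phi2 v b) x \<delta>"

lemma mu_append: "mu v (\<beta> @ \<delta>) = mu_from v (mu v \<beta>) \<delta>"
  by (simp add: mu_def mu_from_def)

lemma mu_from_simps [simp]:
  "mu_from v x [] = x" "mu_from v x (1 # \<delta>) = mu_from v (Phi1 x) \<delta>"
  "mu_from v x (- 1 # \<delta>) = mu_from v (Phi2 v x) \<delta>"
  by (simp_all add: mu_from_def)

lemma tlinear_mu_from: "tlinear (\<lambda>x. mu_from v x \<delta>)"
proof (induction \<delta>)
  case (Cons a \<delta>)
  from tlinear_compose[OF this tlinear_Phi1] tlinear_compose[OF this tlinear_Phi2] show ?case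
    by (cases "a = 1") (simp_all add: mu_from_def)
qed (simp add: tlinear_ident)

lemma tl_e_mu_from:
  assumes "v \<noteq> 0" "x \<in> homog l r" "i \<in> {1..<l}" "set \<delta> \<subseteq> {1, - 1}"
  shows "tl_e v i (mu_from v x \<delta>) = mu_from v (tl_e v i x) \<delta>"
  using assms(2-)
proof (induction \<delta> arbitrary: x l r)
  case (Cons a \<delta>)
  have i: "i \<in> {1..<Suc l}" using Cons.prems(2) by auto
  show ?case
    using Cons.IH[OF Phi1_homog[OF Cons.prems(1)] i] Cons.IH[OF Phi2_homog[OF Cons.prems(1)] i]
      Cons.prems(3) tl_e_Phi1[OF assms(1) Cons.prems(1,2)] tl_e_Phi2[OF assms(1) Cons.prems(1,2)]
    by auto
qed simp

lemma mu_from_mu_span: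
  assumes "v \<noteq> 0" "x \<in> mu_span v l r" "set \<delta> \<subseteq> {1, - 1}"
  shows "mu_from v x \<delta> \<in> mu_span v (l + length \<delta>) (r + sum_list \<delta>)"
  using assms(2-)
proof (induction \<delta> arbitrary: x l r)
  case (Cons a \<delta>)
  then show ?case
    using Cons.IH[OF Phi1_mu_span[OF Cons.prems(1)]] Cons.IH[OF Phi2_mu_span[OF assms(1) Cons.prems(1)]]
    by (auto simp: algebra_simps)
qed simp

text \<open>
  The action of the last generator. In the second formula \<open>v\<^bsup>r+1\<^esup> + v\<^bsup>-1\<^esup> [r + 1] = [r + 2]\<close> is used, and in
  the fourth the coefficient of \<open>F x \<otimes> \<Psi>(1)\<close> is a multiple of \<open>v\<^bsup>r-1\<^esup> + v\<^bsup>-1\<^esup> [r - 1] - [r] = 0\<close>.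
\<close>

lemma tl_e_Phi_Phi:
  assumes v: "v \<noteq> 0" and x: "x \<in> homog l r"
  shows "tl_e v (Suc l) (Phi1 (Phi1 x)) = 0"
    and "0 \<le> r \<Longrightarrow> tl_e v (Suc l) (Phi2 v (Phi1 x)) = tscale (- qint v (r + 2)) (x \<otimes> cup v)"
    and "tl_e v (Suc l) (Phi1 (Phi2 v x)) = tscale (qint v r) (x \<otimes> cup v)"
    and "1 \<le> r \<Longrightarrow> tl_e v (Suc l) (Phi2 v (Phi2 v x)) = 0"
proof -
  let ?T = "tl_e v (Suc l)"
  note T = tl_e_last_letters[OF v x] tl_e_last_letters[OF v Fop_homog[OF x]]
    tl_e_last_letters[OF v Fop_homog[OF Fop_homog[OF x]]]
    tlinear_add[OF tlinear_tl_e] tlinear_diff[OF tlinear_tl_e] tlinear_scale[OF tlinear_tl_e]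
  note F = Fop_snoc tlinear_add[OF tlinear_Fop] tlinear_diff[OF tlinear_Fop] tlinear_scale[OF tlinear_Fop]
  show "?T (Phi1 (Phi1 x)) = 0"
    by (simp add: Phi1_eq tensor_assoc T)
  show "?T (Phi1 (Phi2 v x)) = tscale (qint v r) (x \<otimes> cup v)"
    by (simp add: Phi1_eq Phi2_eq[OF x] tensor_bilinear tensor_assoc T)
  show "?T (Phi2 v (Phi1 x)) = tscale (- qint v (r + 2)) (x \<otimes> cup v)" if "0 \<le> r"
  proof -
    have q: "qint v (r + 2) = v powi (r + 1) + inverse v * qint v (r + 1)"
    proof -
      have "r + 1 + 1 = r + 2" by simp
      then show ?thesis using qint_succ(1)[OF v, of "r + 1"] that by (simp only:)
    qed
    show ?thesis
      unfolding Phi2_eq[OF Phi1_homog[OF x]]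
      by (rule poly_mapping_eqI)
         (simp add: q Phi1_eq F tensor_bilinear tensor_assoc T lookup_minus lookup_add algebra_simps)
  qed
  show "?T (Phi2 v (Phi2 v x)) = 0" if "1 \<le> r"
  proof -
    have q: "qint v r = v powi (r - 1) + inverse v * qint v (r - 1)"
      using qint_succ(1)[OF v, of "r - 1"] that by simp
    have p: "v powi r = v * v powi (r - 1)" using v by (simp add: power_int_diff)
    show ?thesis
      unfolding Phi2_eq[OF Phi2_homog[OF x]] unfolding Phi2_eq[OF x]
      by (rule poly_mapping_eqI)
         (use v in \<open>simp add: q p F tensor_bilinear tensor_assoc T lookup_minus lookup_add algebra_simps power_int_minus\<close>)
  qed
qed

lemma mu_span_tensor_cup:
  assumes v: "v \<noteq> 0" and n: "qfact v n \<noteq> 0" and x: "x \<in> mu_span v l r" and l: "l < n"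
  shows "x \<otimes> cup v \<in> mu_span v (l + 2) r"
proof (cases "0 \<le> r \<and> r \<le> int l")
  case False
  then have "x = 0" using mu_span_trivial[OF x] by blast
  then show ?thesis by (simp add: tensor_bilinear tens.subspace_0[OF subspace_mu_span])
next
  case True
  have "Phi2 v (Phi1 x) - Phi1 (Phi2 v x) \<in> mu_span v (l + 2) r"
    using Phi2_mu_span[OF v Phi1_mu_span[OF x]] Phi1_mu_span[OF Phi2_mu_span[OF v x]]
    by (simp add: tens.subspace_diff[OF subspace_mu_span])
  then have "tscale (qint v (r + 1)) (x \<otimes> cup v) \<in> mu_span v (l + 2) r"
    using tensor_cup[OF v mu_span_homog[OF x]] True by simp
  moreover have "qint v (r + 1) \<noteq> 0" using qint_nonzero[OF n] True l by auto
  ultimately show ?thesis by (rule mem_of_tscale_mem[OF subspace_mu_span])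
qed

lemma tl_e_mu_last:
  assumes v: "v \<noteq> 0" and \<gamma>: "one_factor (\<gamma> @ [a, b])"
  obtains "tl_e v (Suc (length \<gamma>)) (mu v (\<gamma> @ [a, b])) = 0"
  | c where "a + b = 0" "tl_e v (Suc (length \<gamma>)) (mu v (\<gamma> @ [a, b])) = tscale c (mu v \<gamma> \<otimes> cup v)"
proof -
  have ab: "one_factor \<gamma>" "a = 1 \<or> a = - 1" "b = 1 \<or> b = - 1" "0 \<le> sum_list \<gamma> + a + b"
    using one_factor_snoc[of "\<gamma> @ [a]" b] one_factor_snoc[of \<gamma> a] \<gamma> by auto
  have mu: "mu v (\<gamma> @ [a, b]) = mu_from v (mu v \<gamma>) [a, b]" by (rule mu_append)
  note T = tl_e_Phi_Phi[OF v mu_homog[OF one_factor_letters[OF ab(1)], of v]]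
  from ab(2,3) consider "a = 1" "b = 1" | "a = 1" "b = - 1" | "a = - 1" "b = 1" | "a = - 1" "b = - 1"
    by blast
  then show thesis
  proof cases
    case 1
    then show thesis using T(1) that(1) mu by simp
  next
    case 2
    then show thesis
      using T(2)[OF one_factor_sum_nonneg[OF ab(1)]] mu
      by (intro that(2)[of "- qint v (sum_list \<gamma> + 2)"]) simp_all
  next
    case 3
    then show thesis
      using T(3) mu by (intro that(2)[of "qint v (sum_list \<gamma>)"]) simp_all
  next
    case 4
    then have "1 \<le> sum_list \<gamma>" using ab(4) by simp
    with 4 show thesis using T(4) that(1) mu by simp
  qed
qed

text \<open>
  Cut \<open>\<beta>\<close> after the positions \<open>i, i + 1\<close>. The steps after the cut commute with \<open>e\<^sub>i\<close>, and before them \<open>e\<^sub>i\<close>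
  yields a multiple of \<open>\<mu>(\<gamma>) \<otimes> \<Psi>(1)\<close>, which lies in the span by the link formula.
\<close>

lemma tl_e_mu_span:
  assumes v: "v \<noteq> 0" and n: "qfact v n \<noteq> 0" and l: "l \<le> n"
    and x: "x \<in> mu_span v l r" and i: "i \<in> {1..<l}"
  shows "tl_e v i x \<in> mu_span v l r"
proof (rule mu_span_induct[OF x tlinear_tl_e subspace_mu_span])
  fix \<beta> assume \<beta>: "one_factor \<beta>" "length \<beta> = l" "sum_list \<beta> = r"
  obtain \<gamma> a b \<delta> where s: "i = Suc (length \<gamma>)" "\<beta> = \<gamma> @ [a, b] @ \<delta>"
    using word_split_at[OF \<beta>(2) i] by metis
  have f: "one_factor (\<gamma> @ [a, b])" "set \<delta> \<subseteq> {1, - 1}"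
    using one_factor_append[of "\<gamma> @ [a, b]" \<delta>] \<beta>(1) s by auto
  then have g: "one_factor \<gamma>" using one_factor_append by blast
  have "tl_e v i (mu v \<beta>) = mu_from v (tl_e v i (mu v (\<gamma> @ [a, b]))) \<delta>"
    using tl_e_mu_from[OF v mu_homog[OF one_factor_letters[OF f(1)]] _ f(2), of i] mu_append[of v "\<gamma> @ [a, b]" \<delta>] s
    by simp
  moreover have "tl_e v i (mu v (\<gamma> @ [a, b])) \<in> mu_span v (length \<gamma> + 2) (sum_list \<gamma> + a + b)"
    using v f(1)
  proof (cases rule: tl_e_mu_last)
    case 1
    then show ?thesis using s by (simp add: tens.subspace_0[OF subspace_mu_span])
  next
    case (2 c)
    have "length \<gamma> < n" using \<beta>(2) s l by simp
    from mu_span_tensor_cup[OF v n mu_in_mu_span[OF g] this] show ?thesis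
      using 2 s tens.subspace_scale[OF subspace_mu_span] by (simp add: add.assoc)
  qed
  ultimately show "tl_e v i (mu v \<beta>) \<in> mu_span v l r"
    using mu_from_mu_span[OF v _ f(2)] \<beta> s by (fastforce simp: add.assoc)
qed

lemma TL_module_mu_span:
  assumes v: "v \<noteq> 0" and n: "qfact v n \<noteq> 0" and l: "l \<le> n"
  shows "TL_module l (- (v + inverse v)) (tl_e v) (mu_span v l r)"
proof -
  note h = mu_span_homog
  have braid: "tl_e v i (tl_e v j (tl_e v i x)) = tl_e v i x"
    if "i \<in> {1..<l}" "j \<in> {1..<l}" "i = j + 1 \<or> j = i + 1" "x \<in> mu_span v l r" for i j x
  proof -
    from that(1,2) obtain i' j' where "i = Suc i'" "j = Suc j'" by (cases i; cases j) auto
    then show ?thesis using that tl_e_braid[OF v h[OF that(4)]] by auto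
  qed
  have far: "tl_e v i (tl_e v j x) = tl_e v j (tl_e v i x)"
    if "i \<in> {1..<l}" "j \<in> {1..<l}" "i > j + 1 \<or> j > i + 1" "x \<in> mu_span v l r" for i j x
    using that tl_e_commute[OF v h[OF that(4)] that(1,2)] tl_e_commute[OF v h[OF that(4)] that(2,1)] by auto
  show ?thesis
    unfolding TL_module_def TL_stable_def
    using tl_e_mu_span[OF v n l] braid far tl_e_idempotent[OF v h]
    by (auto simp: subspace_mu_span tlinear_add[OF tlinear_tl_e] tlinear_scale[OF tlinear_tl_e])
qed

section \<open>Simplicity\<close>

text \<open>
  The branching rule: restricted to \<open>e\<^sub>1, \<dots>, e\<^bsub>l-1\<^esub>\<close>, the module of length \<open>l + 1\<close> is made of two modules of
  length \<open>l\<close>. By the lemma \<open>Phi_sum_eq_zeroD\<close> below, this decomposition is direct if \<open>[r + 1] \<noteq> 0\<close>.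
\<close>

lemma mu_span_decompose:
  assumes "x \<in> mu_span v (Suc l) r"
  shows "\<exists>u\<in>mu_span v l (r - 1). \<exists>w\<in>mu_span v l (r + 1). x = Phi1 u + Phi2 v w"
proof -
  let ?S = "{x + y |x y. x \<in> Phi1 ` mu_span v l (r - 1) \<and> y \<in> Phi2 v ` mu_span v l (r + 1)}"
  have "tens.subspace ?S"
    by (intro tens.subspace_sums tens_pair.linear_subspace_image tlinear_Phi1 tlinear_Phi2 subspace_mu_span)
  then have "x \<in> ?S"
  proof (rule mu_span_induct[OF assms tlinear_ident])
    fix \<beta> assume \<beta>: "one_factor \<beta>" "length \<beta> = Suc l" "sum_list \<beta> = r"
    then obtain \<gamma> a where s: "\<beta> = \<gamma> @ [a]" by (cases \<beta> rule: rev_cases) auto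
    with \<beta> have g: "one_factor \<gamma>" "a = 1 \<or> a = - 1" by (auto simp: one_factor_snoc)
    have z: "0 \<in> Phi1 ` mu_span v l (r - 1)" "0 \<in> Phi2 v ` mu_span v l (r + 1)"
      using tlinear_zero[OF tlinear_Phi1] tlinear_zero[OF tlinear_Phi2] tens.subspace_0[OF subspace_mu_span]
      by (metis image_eqI)+
    from g(2) show "mu v \<beta> \<in> ?S"
    proof
      assume "a = 1"
      then have "mu v \<beta> \<in> Phi1 ` mu_span v l (r - 1)"
        using mu_in_mu_span[OF g(1), of v] \<beta> s by (auto simp: mu_snoc)
      with z(2) show ?thesis by force
    next
      assume "a = - 1"
      then have "mu v \<beta> \<in> Phi2 v ` mu_span v l (r + 1)"
        using mu_in_mu_span[OF g(1), of v] \<beta> s by (auto simp: mu_snoc)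
      with z(1) show ?thesis by force
    qed
  qed
  then show ?thesis by blast
qed

lemma tensor_eq_zeroD:
  assumes x: "x \<in> homog l r" and 0: "x \<otimes> y = 0" and y: "y \<noteq> 0"
  shows "x = 0"
proof (rule ccontr)
  assume "x \<noteq> 0"
  then obtain u where u: "u \<in> Poly_Mapping.keys x" by (meson ex_in_conv keys_eq_empty)
  obtain w where w: "w \<in> Poly_Mapping.keys y" using y by (meson ex_in_conv keys_eq_empty)
  have "Poly_Mapping.lookup (x \<otimes> y) (u @ w) = Poly_Mapping.lookup x u * Poly_Mapping.lookup y w"
    by (rule lookup_tensor) (use homogD[OF x] u in auto)
  with 0 u w show False by (simp add: in_keys_iff)
qed

lemma word_nonzero: "word w \<noteq> (0 :: 'a::field tens)"
  by (metis keys_word keys_zero insert_not_empty)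

lemma cup_nonzero: "cup v \<noteq> 0"
proof
  assume "cup v = 0"
  then have "Poly_Mapping.lookup (cup v) [1, - 1] = 0" by simp
  then show False by (simp add: cup_eq lookup_minus lookup_word)
qed

text \<open>
  The part of \<open>\<Phi>\<^sub>1(u) + \<Phi>\<^sub>2(w)\<close> that ends in \<open>y\<^bsub>-1\<^esub>\<close> is \<open>[r + 1] w \<otimes> y\<^bsub>-1\<^esub>\<close>.
\<close>

lemma Phi_sum_eq_zeroD:
  assumes u: "u \<in> homog l (r - 1)" and w: "w \<in> homog l (r + 1)" and q: "qint v (r + 1) \<noteq> 0"
    and 0: "Phi1 u + Phi2 v w = 0"
  shows "u = 0" "w = 0"
proof -
  have sum: "(u - tscale (v powi (r + 1)) (Fop v w)) \<otimes> word [1] + tscale (qint v (r + 1)) w \<otimes> word [- 1] = 0"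
    using 0 by (simp add: Phi1_eq Phi2_eq[OF w] tensor_bilinear algebra_simps)
  show "w = 0"
  proof (rule ccontr)
    assume "w \<noteq> 0"
    then obtain t where t: "t \<in> Poly_Mapping.keys w" by (meson ex_in_conv keys_eq_empty)
    have "Poly_Mapping.lookup (tscale (qint v (r + 1)) w \<otimes> word [- 1]) (t @ [- 1]) =
        qint v (r + 1) * Poly_Mapping.lookup w t"
      by (subst lookup_tensor) (use homogD[OF w] t q in \<open>auto simp: lookup_word in_keys_iff\<close>)
    moreover have "Poly_Mapping.lookup ((u - tscale (v powi (r + 1)) (Fop v w)) \<otimes> word [1]) (t @ [- 1]) = 0"
    proof -
      have "t @ [- 1] \<notin> Poly_Mapping.keys ((u - tscale (v powi (r + 1)) (Fop v w)) \<otimes> word [1])"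
        by (auto elim!: keys_tensorE)
      then show ?thesis by (simp add: in_keys_iff)
    qed
    ultimately show False
      using arg_cong[OF sum, of "\<lambda>x. Poly_Mapping.lookup x (t @ [- 1])"] q t
      by (simp add: lookup_add in_keys_iff)
  qed
  with 0 have "u \<otimes> word [1] = 0" by (simp add: Phi1_eq tlinear_zero[OF tlinear_Phi2])
  with tensor_eq_zeroD[OF u] word_nonzero show "u = 0" by blast
qed

text \<open>
  Write \<open>x = \<Phi>\<^sub>1(u) + \<Phi>\<^sub>2(w)\<close>. Then \<open>u\<close> and \<open>w\<close> are killed by the remaining generators, so they vanish
  by induction, except for \<open>w\<close> when its weight equals its length. In that case \<open>w = \<Phi>\<^sub>1(w\<^sub>1)\<close>, and the
  last generator sends \<open>x\<close> to \<open>- [r + 2] w\<^sub>1 \<otimes> \<Psi>(1)\<close>, which is zero only if \<open>w\<^sub>1 = 0\<close>.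
\<close>

lemma killed_vector_zero:
  assumes v: "v \<noteq> 0" and n: "qfact v n \<noteq> 0"
  shows "x \<in> mu_span v l r \<Longrightarrow> r < int l \<Longrightarrow> l \<le> n \<Longrightarrow> (\<And>i. i \<in> {1..<l} \<Longrightarrow> tl_e v i x = 0) \<Longrightarrow> x = 0"
proof (induction l arbitrary: x r)
  case 0
  then show ?case using mu_span_trivial[OF 0(1)] by auto
next
  case (Suc l)
  show ?case
  proof (cases "0 \<le> r")
    case False
    then show ?thesis using mu_span_trivial[OF Suc.prems(1)] by auto
  next
    case r: True
    obtain u w where u: "u \<in> mu_span v l (r - 1)" and w: "w \<in> mu_span v l (r + 1)"
      and x: "x = Phi1 u + Phi2 v w"
      using mu_span_decompose[OF Suc.prems(1)] by blast
    have q: "qint v (r + 1) \<noteq> 0" using qint_nonzero[OF n] r Suc.prems by auto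
    have "tl_e v i u = 0 \<and> tl_e v i w = 0" if i: "i \<in> {1..<l}" for i
    proof -
      have "i \<in> {1..<Suc l}" using i by auto
      with Suc.prems(4) have "tl_e v i x = 0" by blast
      then have "Phi1 (tl_e v i u) + Phi2 v (tl_e v i w) = 0"
        by (simp add: x tlinear_add[OF tlinear_tl_e] tl_e_Phi1[OF v mu_span_homog[OF u] i]
            tl_e_Phi2[OF v mu_span_homog[OF w] i])
      from Phi_sum_eq_zeroD[OF tl_e_homog[OF v mu_span_homog[OF u] i] tl_e_homog[OF v mu_span_homog[OF w] i] q this]
      show ?thesis by blast
    qed
    then have u0: "u = 0" and w0: "r + 1 < int l \<Longrightarrow> w = 0"
      using Suc.IH[OF u] Suc.IH[OF w] Suc.prems by auto
    consider "r + 1 < int l" | "r + 1 > int l" | "r + 1 = int l" by linarith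
    then have "w = 0"
    proof cases
      case 2 then show ?thesis using mu_span_trivial[OF w] by auto
    next
      case 3
      with r obtain m where l: "l = Suc m" by (cases l) auto
      obtain w1 w2 where w1: "w1 \<in> mu_span v m r" and w2: "w2 \<in> mu_span v m (r + 2)"
        and w': "w = Phi1 w1 + Phi2 v w2"
        using mu_span_decompose[of w v m "r + 1"] w l by (auto simp: add.assoc)
      have "w2 = 0" using mu_span_trivial[OF w2] 3 l by auto
      then have w': "w = Phi1 w1" using w' by (simp add: tlinear_zero[OF tlinear_Phi2])
      have "tl_e v (Suc m) x = 0" using Suc.prems(4)[of "Suc m"] l by simp
      then have "tscale (- qint v (r + 2)) (w1 \<otimes> cup v) = 0"
        using tl_e_Phi_Phi(2)[OF v mu_span_homog[OF w1] r]
        by (simp add: x u0 w' tlinear_zero[OF tlinear_Phi1])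
      moreover have "qint v (r + 2) \<noteq> 0" using qint_nonzero[OF n, of "r + 2"] r 3 Suc.prems by auto
      ultimately have "w1 \<otimes> cup v = 0" by simp
      then have "w1 = 0" using tensor_eq_zeroD[OF mu_span_homog[OF w1]] cup_nonzero by blast
      then show ?thesis using w' by (simp add: tlinear_zero[OF tlinear_Phi1])
    qed (rule w0)
    then show ?thesis by (simp add: x u0 tlinear_zero[OF tlinear_Phi1] tlinear_zero[OF tlinear_Phi2])
  qed
qed

lemma tl_e_last_mu_span:
  assumes v: "v \<noteq> 0" and x: "x \<in> mu_span v (Suc (Suc l)) r"
  shows "\<exists>z\<in>mu_span v l r. tl_e v (Suc l) x = z \<otimes> cup v"
proof -
  have "tens.subspace ((\<lambda>z. z \<otimes> cup v) ` mu_span v l r)"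
    by (intro tens_pair.linear_subspace_image tlinear_tensor_left subspace_mu_span)
  then have "tl_e v (Suc l) x \<in> (\<lambda>z. z \<otimes> cup v) ` mu_span v l r"
  proof (rule mu_span_induct[OF x tlinear_tl_e])
    fix \<beta> assume \<beta>: "one_factor \<beta>" "length \<beta> = Suc (Suc l)" "sum_list \<beta> = r"
    have "Suc l \<in> {1..<Suc (Suc l)}" by simp
    then obtain \<gamma> a b t where "\<beta> = \<gamma> @ [a, b] @ t" "length \<gamma> = l"
      using word_split_at[OF \<beta>(2)] by (metis Suc_inject)
    with \<beta>(2) have s: "\<beta> = \<gamma> @ [a, b]" "length \<gamma> = l" by auto
    with \<beta>(1) have g: "one_factor \<gamma>" by (simp add: one_factor_append)
    from v \<beta>(1)[unfolded s(1)] show "tl_e v (Suc l) (mu v \<beta>) \<in> (\<lambda>z. z \<otimes> cup v) ` mu_span v l r"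
    proof (cases rule: tl_e_mu_last)
      case 1
      then show ?thesis
        using s tens.subspace_0[OF subspace_mu_span] by (auto simp: tensor_bilinear intro!: image_eqI[of _ _ 0])
    next
      case (2 c)
      have "tscale c (mu v \<gamma>) \<in> mu_span v l r"
        using mu_in_mu_span[OF g, of v] 2(1) s \<beta>(3) tens.subspace_scale[OF subspace_mu_span] by auto
      then show ?thesis using 2(2) s by (auto simp: tensor_bilinear intro!: image_eqI[of _ _ "tscale c (mu v \<gamma>)"])
    qed
  qed
  then show ?thesis by blast
qed

lemma one_factor_replicate_append:
  "one_factor (replicate k 1 @ \<gamma>) \<longleftrightarrow>
    set \<gamma> \<subseteq> {1, - 1} \<and> (\<forall>i\<le>length \<gamma>. 0 \<le> int k + sum_list (take i \<gamma>))"
proof -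
  have "one_factor (replicate k 1)"
    by (auto simp: one_factor_def sum_list_replicate take_replicate)
  then show ?thesis by (simp add: one_factor_append sum_list_replicate)
qed

lemma first_down_step:
  "set \<beta> \<subseteq> {1, - 1} \<Longrightarrow> sum_list \<beta> < int (length \<beta>) \<Longrightarrow> \<exists>k \<gamma>. \<beta> = replicate k 1 @ - 1 # \<gamma>"
proof (induction \<beta>)
  case (Cons a \<beta>)
  show ?case
  proof (cases "a = 1")
    case True
    with Cons obtain k \<gamma> where "\<beta> = replicate k 1 @ - 1 # \<gamma>" by auto
    with True show ?thesis by (intro exI[of _ "Suc k"] exI[of _ \<gamma>]) simp
  next
    case False
    with Cons.prems show ?thesis by (intro exI[of _ 0] exI[of _ \<beta>]) simp
  qed
qed simp

text \<open>
  A submodule that contains all \<open>z \<otimes> \<Psi>(1)\<close> contains the vectors obtained by inserting the link after any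
  initial part of a 1-factor, since \<open>e\<^sub>i\<close> slides the link to the left. Modulo these vectors the link
  formula with \<open>z = 1\<close> reads \<open>\<Phi>\<^sub>2 \<Phi>\<^sub>1 = \<Phi>\<^sub>1 \<Phi>\<^sub>2\<close>: a step \<open>1, -1\<close> may be replaced by \<open>-1, 1\<close>. In this way the
  first \<open>-1\<close> of \<open>\<beta>\<close> travels to the left until \<open>\<Phi>\<^sub>2\<close> is applied to \<open>1\<close>, which gives \<open>0\<close>.
\<close>

lemma cup_generates_mu_span:
  assumes v: "v \<noteq> 0" and W: "TL_stable (Suc (Suc l)) (tl_e v) W" and r: "r \<le> int l"
    and cups: "\<And>z. z \<in> mu_span v l r \<Longrightarrow> z \<otimes> cup v \<in> W"
  shows "mu_span v (Suc (Suc l)) r \<subseteq> W"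
proof -
  have sub: "tens.subspace W" and e: "\<And>i x. i \<in> {1..<Suc (Suc l)} \<Longrightarrow> x \<in> W \<Longrightarrow> tl_e v i x \<in> W"
    using W by (auto simp: TL_stable_def)
  \<comment> \<open>Induction on the part after the link; each letter is crossed by one generator.\<close>
  have slide: "mu_from v (mu v \<beta> \<otimes> cup v) \<delta> \<in> W"
    if "one_factor (\<beta> @ \<delta>)" "length (\<beta> @ \<delta>) = l" "sum_list (\<beta> @ \<delta>) = r" for \<beta> \<delta>
    using that
  proof (induction \<delta> arbitrary: \<beta>)
    case Nil
    then show ?case using cups mu_in_mu_span[of \<beta> v] by simp
  next
    case (Cons a \<delta>)
    have \<beta>: "one_factor \<beta>" and a: "a \<in> {1, - 1}" and \<delta>: "set \<delta> \<subseteq> {1, - 1}"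
      using Cons.prems(1) by (auto simp: one_factor_append)
    let ?i = "Suc (length \<beta>)"
    have x: "mu v \<beta> \<in> homog (length \<beta>) (sum_list \<beta>)" by (rule mu_homog[OF one_factor_letters[OF \<beta>]])
    have y: "mu v (\<beta> @ [a]) \<otimes> cup v \<in> homog (length \<beta> + 1 + 2) (sum_list \<beta> + a + 0)"
      using mu_homog[of "\<beta> @ [a]" v] one_factor_letters[OF \<beta>] a by (intro tensor_homog cup_homog) auto
    have "mu_from v (mu v (\<beta> @ [a]) \<otimes> cup v) \<delta> \<in> W"
      using Cons.IH[of "\<beta> @ [a]"] Cons.prems by simp
    then have "tl_e v ?i (mu_from v (mu v (\<beta> @ [a]) \<otimes> cup v) \<delta>) \<in> W"
      using Cons.prems(2) by (intro e) auto
    moreover have "tl_e v ?i (mu_from v (mu v (\<beta> @ [a]) \<otimes> cup v) \<delta>) =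
        mu_from v (tl_e v ?i (mu v (\<beta> @ [a]) \<otimes> cup v)) \<delta>"
      by (rule tl_e_mu_from[OF v y _ \<delta>]) auto
    moreover have "mu_from v (tl_e v ?i (mu v (\<beta> @ [a]) \<otimes> cup v)) \<delta> = mu_from v (mu v \<beta> \<otimes> cup v) (a # \<delta>)"
    proof -
      note slide = tl_e_slide_left[OF v x, where z = "word []", unfolded tensor_unit]
        tl_e_slide_left[OF v Fop_homog[OF x], where z = "word []", unfolded tensor_unit]
      have xc: "mu v \<beta> \<otimes> cup v \<in> homog (length \<beta> + 2) (sum_list \<beta>)"
        using tensor_homog[OF x cup_homog] by simp
      have "Fop v (mu v \<beta> \<otimes> cup v) = Fop v (mu v \<beta>) \<otimes> cup v"
        using Fop_tensor[OF v cup_homog] Fop_cup[OF v] by (simp add: tensor_bilinear)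
      then show ?thesis
        using a by (auto simp: mu_snoc Phi1_eq Phi2_eq[OF x] Phi2_eq[OF xc] tensor_bilinear tensor_assoc
            tlinear_diff[OF tlinear_tl_e] tlinear_scale[OF tlinear_tl_e] slide)
    qed
    ultimately show ?case by simp
  qed
  \<comment> \<open>Induction on the number k of steps before the first down step.\<close>
  have first: "mu v (replicate k 1 @ - 1 # \<gamma>) \<in> W"
    if "one_factor (replicate k 1 @ - 1 # \<gamma>)" "length (replicate k 1 @ - 1 # \<gamma>) = Suc (Suc l)"
      "sum_list (replicate k 1 @ - 1 # \<gamma>) = r" for k \<gamma>
    using that
  proof (induction k arbitrary: \<gamma>)
    case 0
    then have "one_factor ([] @ [- 1] @ \<gamma>)" by simp
    then have False using one_factor_append[of "[- 1]" \<gamma>] one_factor_snoc[of "[]" "- 1"] by simp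
    then show ?case ..
  next
    case (Suc k)
    let ?\<beta> = "replicate k (1 :: int)" and ?x = "mu v (replicate k 1)"
    have \<gamma>: "set \<gamma> \<subseteq> {1, - 1}" and sums: "\<And>i. i \<le> length \<gamma> \<Longrightarrow> 0 \<le> int k + sum_list (take i \<gamma>)"
    proof -
      have *: "set (- 1 # \<gamma>) \<subseteq> {1, - 1}"
        "\<forall>i\<le>length (- 1 # \<gamma>). 0 \<le> int (Suc k) + sum_list (take i (- 1 # \<gamma>))"
        using Suc.prems(1) unfolding one_factor_replicate_append by blast+
      then show "set \<gamma> \<subseteq> {1, - 1}" by simp
      show "0 \<le> int k + sum_list (take i \<gamma>)" if "i \<le> length \<gamma>" for i
        using *(2)[rule_format, of "Suc i"] that by simp
    qed
    have \<beta>: "one_factor ?\<beta>" "sum_list ?\<beta> = int k"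
      using one_factor_replicate_append[of k "[]"] by (simp_all add: sum_list_replicate)
    have x: "?x \<in> homog k (int k)" using mu_homog[OF one_factor_letters[OF \<beta>(1)], of v] \<beta>(2) by simp
    have mu: "mu v (replicate (Suc k) 1 @ - 1 # \<gamma>) = mu_from v (Phi2 v (Phi1 ?x)) \<gamma>"
      using mu_append[of v ?\<beta> "1 # - 1 # \<gamma>"] by (simp add: replicate_app_Cons_same)
    have "Phi2 v (Phi1 ?x) = tscale (qint v (int k + 1)) (?x \<otimes> cup v) + Phi1 (Phi2 v ?x)"
      using tensor_cup[OF v x] by simp
    then have split: "mu_from v (Phi2 v (Phi1 ?x)) \<gamma> =
        tscale (qint v (int k + 1)) (mu_from v (?x \<otimes> cup v) \<gamma>) + mu_from v (Phi1 (Phi2 v ?x)) \<gamma>"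
      by (simp only: tlinear_add[OF tlinear_mu_from] tlinear_scale[OF tlinear_mu_from])
    have len: "k + length \<gamma> = l" "int k + sum_list \<gamma> = r"
      using Suc.prems(2,3) by (simp_all add: sum_list_replicate)
    have link: "mu_from v (?x \<otimes> cup v) \<gamma> \<in> W"
    proof (rule slide)
      show "one_factor (?\<beta> @ \<gamma>)" using \<gamma> sums by (simp add: one_factor_replicate_append)
    qed (use len in \<open>simp_all add: sum_list_replicate\<close>)
    have "mu_from v (Phi1 (Phi2 v ?x)) \<gamma> \<in> W"
    proof (cases "k = 0")
      case True
      then have "Phi2 v ?x = 0" using Phi2_mu_zero[OF v \<beta>(1)] \<beta>(2) by simp
      then show ?thesis
        using tens.subspace_0[OF sub]
        by (simp add: tlinear_zero[OF tlinear_Phi1] tlinear_zero[OF tlinear_mu_from])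
    next
      case False
      have "mu v (?\<beta> @ - 1 # 1 # \<gamma>) \<in> W"
      proof (rule Suc.IH)
        have "0 \<le> int k + sum_list (take i (- 1 # 1 # \<gamma>))" if "i \<le> length (- 1 # 1 # \<gamma>)" for i
        proof (cases i)
          case (Suc j)
          then show ?thesis using False sums[of "j - 1"] that by (cases j) auto
        qed simp
        then show "one_factor (?\<beta> @ - 1 # 1 # \<gamma>)"
          unfolding one_factor_replicate_append using \<gamma> by simp
      qed (use len in \<open>simp_all add: sum_list_replicate\<close>)
      then show ?thesis by (simp add: mu_append)
    qed
    with link show ?case
      unfolding mu split by (intro tens.subspace_add[OF sub] tens.subspace_scale[OF sub])
  qed
  have "mu v \<beta> \<in> W" if "\<beta> \<in> factors (Suc (Suc l)) r" for \<beta>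
  proof -
    from that have \<beta>: "one_factor \<beta>" "length \<beta> = Suc (Suc l)" "sum_list \<beta> = r"
      by (auto simp: factors_def)
    with r obtain k \<gamma> where "\<beta> = replicate k 1 @ - 1 # \<gamma>"
      using first_down_step[OF one_factor_letters[OF \<beta>(1)]] by auto
    with first \<beta> show ?thesis by blast
  qed
  then show ?thesis unfolding mu_span_def by (intro tens.span_minimal sub) auto
qed


lemma factors_all_up: "int l \<le> r \<Longrightarrow> factors l r \<subseteq> {replicate l 1}"
proof
  fix \<beta> assume "int l \<le> r" and "\<beta> \<in> factors l r"
  then have \<beta>: "set \<beta> \<subseteq> {1, - 1}" "length \<beta> = l" "int l \<le> sum_list \<beta>"
    by (auto simp: factors_def one_factor_letters)
  then have "count_list \<beta> (- 1) = 0" using sum_list_letters[OF \<beta>(1)] by simp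
  then have "- 1 \<notin> set \<beta>" by (simp add: count_list_0_iff)
  then have "\<beta> = replicate l 1" using \<beta>(1,2) by (intro replicate_eqI) auto
  then show "\<beta> \<in> {replicate l 1}" by simp
qed

lemma mu_span_all_up_simple:
  assumes r: "int l \<le> r" and W: "tens.subspace W" "W \<subseteq> mu_span v l r" "W \<noteq> {0}"
  shows "mu_span v l r \<subseteq> W"
proof -
  let ?m = "mu v (replicate l 1)"
  have sub: "mu v ` factors l r \<subseteq> {?m}" using factors_all_up[OF r] by auto
  obtain x where x: "x \<in> W" "x \<noteq> 0" using W tens.subspace_0[OF W(1)] by auto
  have "x \<in> tens.span {?m}" using x(1) W(2) tens.span_mono[OF sub] by (auto simp: mu_span_def)
  then obtain c where c: "x = tscale c ?m" by (auto simp: tens.span_singleton)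
  with x have "?m \<in> W" using mem_of_tscale_mem[OF W(1), of c ?m] by auto
  with sub have "mu v ` factors l r \<subseteq> W" by auto
  then show ?thesis unfolding mu_span_def using W(1) by (rule tens.span_minimal)
qed

text \<open>
  If \<open>e\<^bsub>m+1\<^esub>\<close> kills \<open>W\<close>, so do all \<open>e\<^sub>i\<close>: for \<open>y \<in> W\<close> also \<open>e\<^sub>i y \<in> W\<close>, and
  \<open>e\<^sub>i y = e\<^sub>i (e\<^bsub>i+1\<^esub> (e\<^sub>i y)) = 0\<close> as soon as \<open>e\<^bsub>i+1\<^esub>\<close> kills \<open>W\<close>. But some \<open>e\<^sub>i\<close> acts nontrivially on \<open>W\<close>.
\<close>

lemma last_generator_acts:
  assumes v: "v \<noteq> 0" and n: "qfact v n \<noteq> 0" and l: "l \<le> n" and r: "r < int l"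
    and W: "TL_stable l (tl_e v) W" "W \<subseteq> mu_span v l r" "W \<noteq> {0}"
  obtains m x where "l = Suc (Suc m)" "x \<in> W" "tl_e v (Suc m) x \<noteq> 0"
proof -
  have sub: "tens.subspace W" and e: "\<And>i x. i \<in> {1..<l} \<Longrightarrow> x \<in> W \<Longrightarrow> tl_e v i x \<in> W"
    using W by (auto simp: TL_stable_def)
  obtain x where x: "x \<in> W" "x \<noteq> 0" using W tens.subspace_0[OF sub] by auto
  obtain i where i: "i \<in> {1..<l}" "tl_e v i x \<noteq> 0"
    using killed_vector_zero[OF v n _ r l, of x] x W(2) by blast
  then have "2 \<le> l" by auto
  then obtain m where m: "l = Suc (Suc m)" by (metis add_2_eq_Suc le_Suc_ex)
  have "\<exists>y\<in>W. tl_e v (Suc m) y \<noteq> 0"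
  proof (rule ccontr)
    assume "\<not> ?thesis"
    then have last: "tl_e v (Suc m) y = 0" if "y \<in> W" for y using that by blast
    \<comment> \<open>Descend from the last generator; d counts the steps.\<close>
    have "\<forall>y\<in>W. tl_e v (Suc (m - d)) y = 0" for d
    proof (induction d)
      case 0 then show ?case using last by simp
    next
      case (Suc d)
      show ?case
      proof (cases "d < m")
        case True
        then obtain k where k: "m - d = Suc k" "m - Suc d = k" "Suc (Suc k) < l"
          using m by (intro that[of "m - Suc d"]) auto
        show ?thesis
        proof
          fix y assume y: "y \<in> W"
          then have "tl_e v (Suc k) y \<in> W" using k m by (intro e) auto
          with Suc.IH k have "tl_e v (Suc (Suc k)) (tl_e v (Suc k) y) = 0" by metis
          then have "tl_e v (Suc k) y = tl_e v (Suc k) 0"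
            using tl_e_braid(1)[OF v mu_span_homog[OF subsetD[OF W(2) y]] k(3)] by simp
          then show "tl_e v (Suc (m - Suc d)) y = 0"
            by (simp add: k tlinear_zero[OF tlinear_tl_e])
        qed
      next
        case False
        then show ?thesis using Suc.IH by simp
      qed
    qed
    from this[of "m - (i - 1)"] i m x(1) have "tl_e v i x = 0" by auto
    with i show False by blast
  qed
  with m that show thesis by blast
qed

text \<open>
  The vectors \<open>z\<close> of length \<open>l - 2\<close> with \<open>z \<otimes> \<Psi>(1) \<in> W\<close> form a nonzero submodule, which is everything by
  induction; then \<open>W\<close> is everything as well.
\<close>

lemma mu_span_simple:
  assumes v: "v \<noteq> 0" and n: "qfact v n \<noteq> 0"
  shows "l \<le> n \<Longrightarrow> TL_stable l (tl_e v) W \<Longrightarrow> W \<subseteq> mu_span v l r \<Longrightarrow> W = {0} \<or> W = mu_span v l r"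
proof (induction l arbitrary: W rule: less_induct)
  case (less l)
  have "mu_span v l r \<subseteq> W" if nz: "W \<noteq> {0}"
  proof (cases "int l \<le> r")
    case True
    then show ?thesis
      using less.prems nz by (intro mu_span_all_up_simple) (simp_all add: TL_stable_def)
  next
    case False
    then have "r < int l" by simp
    from last_generator_acts[OF v n less.prems(1) this less.prems(2,3) nz]
    obtain m x where m: "l = Suc (Suc m)" and x: "x \<in> W" "tl_e v (Suc m) x \<noteq> 0" .
    have sub: "tens.subspace W" and e: "\<And>i x. i \<in> {1..<l} \<Longrightarrow> x \<in> W \<Longrightarrow> tl_e v i x \<in> W"
      using less.prems(2) by (auto simp: TL_stable_def)
    obtain z where z: "z \<in> mu_span v m r" "tl_e v (Suc m) x = z \<otimes> cup v"
      using tl_e_last_mu_span[OF v, of x m r] x(1) less.prems(3) m by blast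
    let ?U = "mu_span v m r \<inter> {z. z \<otimes> cup v \<in> W}"
    have "z \<in> ?U" using z e[of "Suc m" x] x m by auto
    moreover have "z \<noteq> 0" using x(2) z(2) by (auto simp: tensor_bilinear)
    moreover have "TL_stable m (tl_e v) ?U"
      unfolding TL_stable_def
    proof (intro conjI ballI)
      show "tens.subspace ?U"
        by (intro tens.subspace_inter subspace_mu_span tlinear_vimage_subspace tlinear_tensor_left sub)
      fix i y assume i: "i \<in> {1..<m}" and y: "y \<in> ?U"
      then have "tl_e v i (y \<otimes> cup v) \<in> W" using m by (intro e) auto
      moreover have "y \<in> homog m r" using y mu_span_homog by blast
      ultimately have "tl_e v i y \<otimes> cup v \<in> W" using tl_e_tensor[OF v _ i] by metis
      moreover have "tl_e v i y \<in> mu_span v m r"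
        using tl_e_mu_span[OF v n _ _ i] y less.prems(1) m by auto
      ultimately show "tl_e v i y \<in> ?U" by simp
    qed
    ultimately have "?U = mu_span v m r"
      using less.IH[of m ?U] less.prems(1) m by auto
    then have cups: "z \<otimes> cup v \<in> W" if "z \<in> mu_span v m r" for z using that by blast
    show ?thesis
    proof (cases "r \<le> int m")
      case True
      then show ?thesis using cup_generates_mu_span[OF v _ True cups] less.prems(2) m by simp
    next
      case False
      then have "z = 0" using mu_span_trivial[OF z(1)] by simp
      with \<open>z \<noteq> 0\<close> show ?thesis ..
    qed
  qed
  with less.prems(3) show ?case by blast
qed

lemma factors_nonempty: "b \<le> a \<Longrightarrow> replicate a 1 @ replicate b (- 1) \<in> factors (a + b) (int a - int b)"
  by (auto simp: factors_def one_factor_replicate_append take_replicate sum_list_replicate)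

lemma simple_TL_module_mu_span:
  assumes v: "v \<noteq> 0" and n: "qfact v n \<noteq> 0" and "b \<le> a" "a + b \<le> n"
  shows "simple_TL_module (a + b) (- (v + inverse v)) (tl_e v) (mu_span v (a + b) (int a - int b))"
proof -
  let ?\<beta> = "replicate a (1 :: int) @ replicate b (- 1)"
  have \<beta>: "?\<beta> \<in> factors (a + b) (int a - int b)" by (rule factors_nonempty[OF assms(3)])
  then have "led_by ?\<beta> (mu v ?\<beta>)" using assms(4) by (intro mu_led_by[OF v n]) (auto simp: factors_def)
  then have "mu v ?\<beta> \<noteq> 0" by (auto simp: led_by_def)
  moreover have "mu v ?\<beta> \<in> mu_span v (a + b) (int a - int b)"
    using \<beta> unfolding mu_span_def by (intro tens.span_base) simp
  ultimately have "mu_span v (a + b) (int a - int b) \<noteq> {0}" by auto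
  then show ?thesis
    unfolding simple_TL_module_def
    using TL_module_mu_span[OF v n assms(4)] mu_span_simple[OF v n assms(4)] by blast
qed

section \<open>The triangular expansion\<close>

text \<open>
  In \<open>\<eta>(\<alpha>)\<close> the word \<open>\<alpha>\<close> occurs. Among the \<open>\<mu>(\<beta>)\<close> with \<open>\<beta> \<le> \<alpha>\<close> only \<open>\<mu>(\<alpha>)\<close> contains it, so its scalar
  cannot vanish.
\<close>

lemma eta_expansion:
  assumes v: "v \<noteq> 0" and n: "qfact v n \<noteq> 0" and \<alpha>: "one_factor \<alpha>" "length \<alpha> \<le> n"
  defines "I \<equiv> factors (length \<alpha>) (sum_list \<alpha>)"
  obtains c where "eta v \<alpha> = (\<Sum>\<beta>\<in>I. tscale (c \<beta>) (mu v \<beta>))"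
    "\<And>\<beta>. \<beta> \<in> I \<Longrightarrow> c \<beta> \<noteq> 0 \<Longrightarrow> one_factor_le \<beta> \<alpha>" "c \<alpha> \<noteq> 0"
proof -
  have fin: "finite I" and len: "\<And>\<beta>. \<beta> \<in> I \<Longrightarrow> length \<beta> = length \<alpha>"
    by (simp_all add: I_def finite_factors) (simp add: factors_def)
  have led: "led_by \<beta> (mu v \<beta>)" if "\<beta> \<in> I" for \<beta>
    using that \<alpha> by (intro mu_led_by[OF v n]) (auto simp: I_def factors_def)
  have \<alpha>I: "\<alpha> \<in> I" using \<alpha> by (simp add: I_def factors_def)
  have eta: "led_by \<alpha> (eta v \<alpha>)" by (rule eta_led_by[OF \<alpha>(1)])
  obtain c where c: "eta v \<alpha> = (\<Sum>\<beta>\<in>I. tscale (c \<beta>) (mu v \<beta>))"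
    using span_family_coefficients[OF fin] eta_in_mu_span[OF v n \<alpha>] by (auto simp: mu_span_def I_def)
  have le: "one_factor_le \<beta> \<alpha>" if "\<beta> \<in> I" "c \<beta> \<noteq> 0" for \<beta>
    using led_family_below[where f = "mu v" and c = c, OF fin len led _ that] eta c by (simp add: led_by_def)
  have "c \<alpha> \<noteq> 0"
  proof
    assume 0: "c \<alpha> = 0"
    have "c \<beta> * Poly_Mapping.lookup (mu v \<beta>) \<alpha> = 0" if \<beta>: "\<beta> \<in> I" for \<beta>
    proof (rule ccontr)
      assume "\<not> ?thesis"
      then have ne: "c \<beta> \<noteq> 0" "\<alpha> \<in> Poly_Mapping.keys (mu v \<beta>)" by (auto simp: in_keys_iff)
      then have "one_factor_le \<alpha> \<beta>" using led[OF \<beta>] by (auto simp: led_by_def dest: belowD)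
      with le[OF \<beta> ne(1)] have "\<beta> = \<alpha>" by (intro one_factor_le_antisym)
      with ne 0 show False by simp
    qed
    then have "Poly_Mapping.lookup (eta v \<alpha>) \<alpha> = 0" 
      unfolding c lookup_sum lookup_tscale by (rule sum.neutral[rule_format])
    with eta show False by (simp add: led_by_def)
  qed
  with c le that show thesis by blast
qed

lemma same_shape_factors:
  assumes "one_factor \<alpha>"
  shows "{\<beta>. one_factor \<beta> \<and> shape \<beta> = shape \<alpha> \<and> one_factor_le \<beta> \<alpha>} =
    {\<beta> \<in> factors (length \<alpha>) (sum_list \<alpha>). one_factor_le \<beta> \<alpha>}"
  using sum_list_letters one_factor_letters assms
  by (fastforce simp: factors_def shape_def one_factor_le_def)

theorem corollary4p9:
  fixes v :: "'a::field" and n :: nat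
  assumes "v \<noteq> 0" and "qfact v n \<noteq> 0"
  shows
    "(\<exists>\<pi> :: int list \<Rightarrow> int list \<Rightarrow> 'a.
        (\<forall>\<alpha>. one_factor \<alpha> \<and> length \<alpha> \<le> n \<longrightarrow>
           eta v \<alpha> = (\<Sum>\<beta> | one_factor \<beta> \<and> shape \<beta> = shape \<alpha> \<and> one_factor_le \<beta> \<alpha>.
                        tscale (\<pi> \<alpha> \<beta>) (mu v \<beta>))
           \<and> \<pi> \<alpha> \<alpha> \<noteq> 0)
      \<and> (\<forall>a b. b \<le> a \<and> a + b \<le> n \<longrightarrow>
           (\<forall>\<alpha>\<in>of_shape (a, b). eta v \<alpha> = (\<Sum>\<beta>\<in>of_shape (a, b). tscale (\<pi> \<alpha> \<beta>) (mu v \<beta>)))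
           \<and> triangular_on (of_shape (a, b)) one_factor_le \<pi>
           \<and> invertible_on (of_shape (a, b)) \<pi>))
     \<and> (\<forall>a b. b \<le> a \<and> a + b \<le> n \<longrightarrow>
           simple_TL_module (a + b) (- (v + inverse v)) (tl_e v) (cell v (a, b))
           \<and> inj_on (eta v) (of_shape (a, b))
           \<and> tens.independent (eta v ` of_shape (a, b))
           \<and> tens.span (eta v ` of_shape (a, b)) = cell v (a, b))"
proof -
  let ?E = "\<lambda>\<alpha> c. one_factor \<alpha> \<and> length \<alpha> \<le> n \<longrightarrow>
      eta v \<alpha> = (\<Sum>\<beta>\<in>factors (length \<alpha>) (sum_list \<alpha>). tscale (c \<beta>) (mu v \<beta>))
      \<and> (\<forall>\<beta>\<in>factors (length \<alpha>) (sum_list \<alpha>). c \<beta> \<noteq> 0 \<longrightarrow> one_factor_le \<beta> \<alpha>) \<and> c \<alpha> \<noteq> 0"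
  have "\<exists>c. ?E \<alpha> c" for \<alpha>
  proof (cases "one_factor \<alpha> \<and> length \<alpha> \<le> n")
    case True
    then obtain c where "eta v \<alpha> = (\<Sum>\<beta>\<in>factors (length \<alpha>) (sum_list \<alpha>). tscale (c \<beta>) (mu v \<beta>))"
      "\<And>\<beta>. \<beta> \<in> factors (length \<alpha>) (sum_list \<alpha>) \<Longrightarrow> c \<beta> \<noteq> 0 \<Longrightarrow> one_factor_le \<beta> \<alpha>" "c \<alpha> \<noteq> 0"
      using eta_expansion[OF assms, of \<alpha>] by blast
    then show ?thesis by blast
  qed blast
  then obtain \<pi> where E: "\<And>\<alpha>. ?E \<alpha> (\<pi> \<alpha>)"
    using choice[of ?E] by blast
  have \<pi>: "eta v \<alpha> = (\<Sum>\<beta>\<in>factors (length \<alpha>) (sum_list \<alpha>). tscale (\<pi> \<alpha> \<beta>) (mu v \<beta>))"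
    and le: "\<And>\<beta>. \<beta> \<in> factors (length \<alpha>) (sum_list \<alpha>) \<Longrightarrow> \<pi> \<alpha> \<beta> \<noteq> 0 \<Longrightarrow> one_factor_le \<beta> \<alpha>"
    and diag: "\<pi> \<alpha> \<alpha> \<noteq> 0"
    if "one_factor \<alpha>" "length \<alpha> \<le> n" for \<alpha>
    using E[of \<alpha>] that by blast+
  have expansion: "eta v \<alpha> = (\<Sum>\<beta> | one_factor \<beta> \<and> shape \<beta> = shape \<alpha> \<and> one_factor_le \<beta> \<alpha>.
      tscale (\<pi> \<alpha> \<beta>) (mu v \<beta>))" if "one_factor \<alpha>" "length \<alpha> \<le> n" for \<alpha>
    unfolding \<pi>[OF that] same_shape_factors[OF that(1)]
  proof (rule sum.mono_neutral_right)
    show "\<forall>\<beta>\<in>factors (length \<alpha>) (sum_list \<alpha>)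
        - {\<beta> \<in> factors (length \<alpha>) (sum_list \<alpha>). one_factor_le \<beta> \<alpha>}. tscale (\<pi> \<alpha> \<beta>) (mu v \<beta>) = 0"
      using le[OF that] by fastforce
  qed (simp_all add: finite_factors)
  have shape: "(\<forall>\<alpha>\<in>of_shape (a, b). eta v \<alpha> = (\<Sum>\<beta>\<in>of_shape (a, b). tscale (\<pi> \<alpha> \<beta>) (mu v \<beta>)))
       \<and> triangular_on (of_shape (a, b)) one_factor_le \<pi> \<and> invertible_on (of_shape (a, b)) \<pi>
       \<and> simple_TL_module (a + b) (- (v + inverse v)) (tl_e v) (cell v (a, b))
       \<and> inj_on (eta v) (of_shape (a, b)) \<and> tens.independent (eta v ` of_shape (a, b))
       \<and> tens.span (eta v ` of_shape (a, b)) = cell v (a, b)"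
    if ab: "b \<le> a" "a + b \<le> n" for a b
  proof -
    let ?I = "factors (a + b) (int a - int b)"
    have fin: "finite ?I" by (rule finite_factors)
    have I: "\<alpha> \<in> ?I \<Longrightarrow> one_factor \<alpha> \<and> length \<alpha> = a + b \<and> length \<alpha> \<le> n \<and> sum_list \<alpha> = int a - int b" for \<alpha>
      using ab(2) by (auto simp: factors_def)
    have len: "\<alpha> \<in> ?I \<Longrightarrow> length \<alpha> = a + b" for \<alpha> using I by blast
    have led_mu: "\<alpha> \<in> ?I \<Longrightarrow> led_by \<alpha> (mu v \<alpha>)" for \<alpha> using I mu_led_by[OF assms] by blast
    have led_eta: "\<alpha> \<in> ?I \<Longrightarrow> led_by \<alpha> (eta v \<alpha>)" for \<alpha> using I eta_led_by by blast
    have P: "eta v \<alpha> = (\<Sum>\<beta>\<in>?I. tscale (\<pi> \<alpha> \<beta>) (mu v \<beta>))" if "\<alpha> \<in> ?I" for \<alpha>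
      using \<pi>[of \<alpha>] I[OF that] by simp
    have tri: "triangular_on ?I one_factor_le \<pi>"
      unfolding triangular_on_def using le I by metis
    have cell: "cell v (a, b) = mu_span v (a + b) (int a - int b)"
      by (simp add: cell_def mu_span_def of_shape_factors[OF ab(1)])
    have "eta v ` ?I \<subseteq> tens.span (mu v ` ?I)"
    proof (rule image_subsetI)
      fix \<alpha> assume "\<alpha> \<in> ?I"
      then show "eta v \<alpha> \<in> tens.span (mu v ` ?I)"
        using I[of \<alpha>] eta_in_mu_span[OF assms, of \<alpha>] by (simp add: mu_span_def)
    qed
    then have "tens.span (eta v ` ?I) = mu_span v (a + b) (int a - int b)"
      unfolding mu_span_def by (intro span_eq_of_led_families[OF fin len led_eta]) auto
    then show ?thesis
      unfolding cell of_shape_factors[OF ab(1)]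
      using P tri transition_matrix_invertible[OF fin len led_eta led_mu P]
        simple_TL_module_mu_span[OF assms ab] led_family_inj[OF led_eta]
        led_family_independent[OF fin len led_eta]
      by blast
  qed
  show ?thesis
    using expansion diag shape by (intro conjI exI[of _ \<pi>] allI impI) simp_all
qed

end
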